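(* Let $p\ge1$ be odd, let $n_{\mathrm{el}}\ge2$, and take the knots $\xi_i=\frac{i}{n_{\mathrm{el}}}$, $i=-p,\dots,n_{\mathrm{el}}+p$. Then the functions $N^p_{1,\boldsymbol\xi,0},\dots,N^p_{n_{\mathrm{el}}-1,\boldsymbol\xi,0}$ (restricted to $[0,1]$) defined by $$\begin{bmatrix}N^p_{1,\boldsymbol\xi,0}\\ \vdots\\ N^p_{n_{\mathrm{el}}-1,\boldsymbol\xi,0}\end{bmatrix}=E_{n_{\mathrm{el}}-1,\,(p+1)/2}\begin{bmatrix}N^p_{-p,\boldsymbol\xi}\\ \vdots\\ N^p_{n_{\mathrm{el}}-1,\boldsymbol\xi}\end{bmatrix}$$ are a basis of the optimal space $\mathbb{S}^{\mathrm{opt}}_{p,n_{\mathrm{el}}-1,0}$. Likewise, let $p\ge2$ be even, let $n_{\mathrm{el}}\ge3$, and take the knots $\xi_i=\frac{i-1/2}{n_{\mathrm{el}}-1}$, $i=-p,\dots,n_{\mathrm{el}}+p$. Then the functions $N^p_{1,\boldsymbol\xi,0},\dots,N^p_{n_{\mathrm{el}}-2,\boldsymbol\xi,0}$ (restricted to $[0,1]$) defined by $$\begin{bmatrix}N^p_{1,\boldsymbol\xi,0}\\ \vdots\\ N^p_{n_{\mathrm{el}}-2,\boldsymbol\xi,0}\end{bmatrix}=E_{n_{\mathrm{el}}-2,\,p/2+1}\begin{bmatrix}N^p_{-p,\boldsymbol\xi}\\ \vdots\\ N^p_{n_{\mathrm{el}}-1,\boldsymbol\xi}\end{bmatrix}$$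 are a basis of the optimal space $\mathbb{S}^{\mathrm{opt}}_{p,n_{\mathrm{el}}-2,0}$.
   Context: Cardinal B-splines: $\mathcal{N}_0(t)=1$ for $t\in[0,1)$ and $0$ otherwise; $\mathcal{N}_p(t)=\frac tp\mathcal{N}_{p-1}(t)+\frac{p+1-t}{p}\mathcal{N}_{p-1}(t-1)$ for $p\ge1$. For equally spaced knots $\boldsymbol\xi=(\xi_{-p},\dots,\xi_{n_{\mathrm{el}}+p})$, the B-splines are $N^p_{i,\boldsymbol\xi}(x)=\mathcal{N}_p\left(\frac{n_{\mathrm{el}}(x-\xi_i)}{\xi_{n_{\mathrm{el}}}-\xi_0}\right)$, $i=-p,\dots,n_{\mathrm{el}}-1$. Extraction matrices: let $I_m$ be the $m\times m$ identity, $J_m$ the $m\times m$ exchange matrix (ones on the anti-diagonal, zeros elsewhere), $\boldsymbol 0_m$ the zero column of length $m$, and $$L_m=[\,I_m\,|\,\boldsymbol0_m\,|\,-J_m\,|\,\boldsymbol0_m\,],\qquad R_m=[\,\boldsymbol0_m\,|\,-J_m\,|\,\boldsymbol0_m\,|\,I_m\,].$$ For $m,k\ge1$, $E_{m,k}$ is the $m\times(m+2k)$ matrix obtained from the bi-infinite horizontal concatenation $[\cdots|L_m|L_m|\,I_m\,|R_m|R_m|\cdots]$ by keeping the central block $I_m$, the $k$ columns immediately to its left and the $k$ columns immediately to its right. (In both cases of the claim $m+2k=n_{\mathrm{el}}+p$.) Optimal space: for break points $\boldsymbol\tau$ of $[0,1]$ (including $0$ and $1$), $\mathbb{S}_{p,\boldsymbol\tau}$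 is the space of functions in $C^{p-1}[0,1]$ that are polynomials of degree at most $p$ on each element of the partition. $\mathbb{S}^{\mathrm{opt}}_{p,n,0}$ is the space (of dimension $n$) of all $s\in\mathbb{S}_{p,\boldsymbol\tau}$ with $s^{(\alpha)}(0)=s^{(\alpha)}(1)=0$ for all even $\alpha$, $0\le\alpha\le p$ (one-sided derivatives), where $\boldsymbol\tau=\left(0,\frac{1}{n+1},\frac{2}{n+1},\dots,\frac{n}{n+1},1\right)$ if $p$ is odd and $\boldsymbol\tau=\left(0,\frac{1/2}{n+1},\frac{3/2}{n+1},\dots,\frac{n+1/2}{n+1},1\right)$ if $p$ is even. *)

theory Defs
  imports
    "HOL-Analysis.Analysis"
    "HOL-Library.Function_Algebras"
    "HOL-Computational_Algebra.Polynomial"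
    "Jordan_Normal_Form.Matrix"
begin

no_notation vec_nth (infixl \<open>$\<close> 90)

section \<open>B-splines\<close>

fun cardinal_bspline :: "nat \<Rightarrow> real \<Rightarrow> real" where
  "cardinal_bspline 0 t = (if 0 \<le> t \<and> t < 1 then 1 else 0)"
| "cardinal_bspline (Suc q) t =
     t / real (Suc q) * cardinal_bspline q t
     + (real (Suc q) + 1 - t) / real (Suc q) * cardinal_bspline q (t - 1)"

text \<open>A knot sequence is a function on the integers, of which only the values at
  \<open>-p, \<dots>, nel + p\<close> are relevant.\<close>

definition bspline :: "nat \<Rightarrow> nat \<Rightarrow> (int \<Rightarrow> real) \<Rightarrow> int \<Rightarrow> real \<Rightarrow> real" where
  "bspline p nel \<xi> i x =
     cardinal_bspline p (real nel * (x - \<xi> i) / (\<xi> (int nel) - \<xi> 0))"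

section \<open>Extraction matrices\<close>

definition append_cols :: "'a::zero mat \<Rightarrow> 'a mat \<Rightarrow> 'a mat" (infixr \<open>@\<^sub>c\<close> 65) where
  "A @\<^sub>c B = four_block_mat A B (0\<^sub>m 0 (dim_col A)) (0\<^sub>m 0 (dim_col B))"

definition exchange_mat :: "nat \<Rightarrow> real mat" where
  "exchange_mat m = mat m m (\<lambda>(i, j). if i + j + 1 = m then 1 else 0)"

definition L_mat :: "nat \<Rightarrow> real mat" where
  "L_mat m = 1\<^sub>m m @\<^sub>c 0\<^sub>m m 1 @\<^sub>c - exchange_mat m @\<^sub>c 0\<^sub>m m 1"

definition R_mat :: "nat \<Rightarrow> real mat" where
  "R_mat m = 0\<^sub>m m 1 @\<^sub>c - exchange_mat m @\<^sub>c 0\<^sub>m m 1 @\<^sub>c 1\<^sub>m m"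

text \<open>Entry in row \<open>i < m\<close> and column \<open>j\<close> of the bi-infinite concatenation
  \<open>[\<cdots> | L | L | I | R | R | \<cdots>]\<close>, whose columns are numbered by the integers so
  that the central block \<open>I\<close> occupies the columns \<open>0, \<dots>, m - 1\<close>. As both \<open>L\<close> and \<open>R\<close>
  have \<open>2 m + 2\<close> columns and \<open>mod\<close> is nonnegative, the column \<open>-1\<close> is the last column of
  a copy of \<open>L\<close>, and the column \<open>m\<close> is the first column of a copy of \<open>R\<close>.\<close>

definition biinfinite_entry :: "nat \<Rightarrow> nat \<Rightarrow> int \<Rightarrow> real" where
  "biinfinite_entry m i j =
     (if j < 0 then L_mat m $$ (i, nat (j mod int (2 * m + 2)))
      else if j < int m then 1\<^sub>m m $$ (i, nat j)
      else R_mat m $$ (i, nat ((j - int m) mod int (2 * m + 2))))"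

definition extraction_mat :: "nat \<Rightarrow> nat \<Rightarrow> real mat" where
  "extraction_mat m k =
     mat m (m + 2 * k) (\<lambda>(i, c). biinfinite_entry m i (int c - int k))"

section \<open>Functions on the unit interval and bases\<close>

text \<open>A function on \<open>[0,1]\<close> is represented by a function on the reals that vanishes
  outside \<open>[0,1]\<close>. Hence two such functions are equal iff they agree on \<open>[0,1]\<close>.\<close>

definition restrict01 :: "(real \<Rightarrow> real) \<Rightarrow> real \<Rightarrow> real" where
  "restrict01 f x = (if x \<in> {0..1} then f x else 0)"

definition fun_scale :: "real \<Rightarrow> (real \<Rightarrow> real) \<Rightarrow> real \<Rightarrow> real" where
  "fun_scale c f = (\<lambda>x. c * f x)"

global_interpretation real_fun: vector_space fun_scale
  by unfold_locales (auto simp: fun_scale_def fun_eq_iff algebra_simps)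

definition is_basis_family :: "('i \<Rightarrow> real \<Rightarrow> real) \<Rightarrow> 'i set \<Rightarrow> (real \<Rightarrow> real) set \<Rightarrow> bool" where
  "is_basis_family f I V \<longleftrightarrow>
     inj_on f I \<and> real_fun.independent (f ` I) \<and> real_fun.span (f ` I) = V"

section \<open>Boundary-modified B-splines\<close>

text \<open>Entry \<open>i = 1, \<dots>, m\<close> of the product of the extraction matrix with the column of the
  B-splines with indices \<open>-p, \<dots>, nel - 1\<close>, restricted to \<open>[0,1]\<close>; it is meant for
  \<open>m + 2 k = nel + p\<close>. Rows of matrices are numbered from 0.\<close>

definition reduced_bspline ::
  "nat \<Rightarrow> nat \<Rightarrow> (int \<Rightarrow> real) \<Rightarrow> nat \<Rightarrow> nat \<Rightarrow> nat \<Rightarrow> real \<Rightarrow> real" where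
  "reduced_bspline p nel \<xi> m k i = restrict01 (\<lambda>x.
     (extraction_mat m k *\<^sub>v Matrix.vec (nel + p) (\<lambda>c. bspline p nel \<xi> (int c - int p) x)) $ (i - 1))"

section \<open>Optimal spline spaces\<close>

text \<open>Iterated derivative on \<open>[0,1]\<close>, one-sided at the two end points.\<close>

definition deriv01 :: "nat \<Rightarrow> (real \<Rightarrow> real) \<Rightarrow> real \<Rightarrow> real" where
  "deriv01 k s = ((\<lambda>f x. vector_derivative f (at x within {0..1})) ^^ k) s"

definition C01 :: "nat \<Rightarrow> (real \<Rightarrow> real) set" where
  "C01 k = {s. (\<forall>j<k. deriv01 j s differentiable_on {0..1}) \<and>
               continuous_on {0..1} (deriv01 k s)}"

text \<open>\<open>\<tau>\<close> lists the break points in increasing order. This is for \<open>p \<ge> 1\<close>: then splines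
  are continuous, and the elements may be taken to be closed intervals.\<close>

definition spline_space :: "nat \<Rightarrow> real list \<Rightarrow> (real \<Rightarrow> real) set" where
  "spline_space p \<tau> = {s. s \<in> C01 (p - 1) \<and> (\<forall>x. x \<notin> {0..1} \<longrightarrow> s x = 0) \<and>
     (\<forall>j < length \<tau> - 1. \<exists>q::real poly. degree q \<le> p \<and>
        (\<forall>x \<in> {\<tau> ! j .. \<tau> ! (j + 1)}. s x = poly q x))}"

definition opt_breaks :: "nat \<Rightarrow> nat \<Rightarrow> real list" where
  "opt_breaks p n =
     (if odd p then map (\<lambda>j. real j / real (n + 1)) [0..<n + 2]
      else [0] @ map (\<lambda>j. (real j + 1 / 2) / real (n + 1)) [0..<n + 1] @ [1])"

text \<open>If \<open>p\<close> is even, the condition for \<open>\<alpha> = p\<close> makes sense although \<open>s\<close> is only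
  assumed to be \<open>p - 1\<close> times differentiable, as \<open>s\<close> is a polynomial near 0 and near 1.\<close>

definition opt_space :: "nat \<Rightarrow> nat \<Rightarrow> (real \<Rightarrow> real) set" where
  "opt_space p n = {s \<in> spline_space p (opt_breaks p n).
     \<forall>\<alpha>\<le>p. even \<alpha> \<longrightarrow> deriv01 \<alpha> s 0 = 0 \<and> deriv01 \<alpha> s 1 = 0}"

end

theory Submission
  imports Defs
begin

text \<open>
  Put \<open>M = n + 1\<close> and let \<open>\<phi>\<close> be the cardinal B-spline of degree \<open>p\<close> centered at the origin.
  The rows of the extraction matrix are the sequences that are odd and \<open>2 M\<close>-periodic and
  equal to a unit vector on \<open>{1..M - 1}\<close>, so the claim says that \<open>b \<mapsto> (\<Sum>l. b l * \<phi> (M x - l))\<close> is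
  an isomorphism from the odd \<open>2 M\<close>-periodic sequences onto the optimal space. This is shown by induction
  from \<open>p\<close> to \<open>p + 2\<close>: a function lies in the optimal space of degree \<open>p + 2\<close> iff it vanishes at 0 and 1
  and its second derivative lies in that of degree \<open>p\<close>, the second derivative acts on the coefficients
  as the second difference, and the second difference is bijective on odd \<open>2 M\<close>-periodic
  sequences (a discrete Dirichlet problem). For \<open>p = 1\<close> the coefficients are the values at the
  break points; for \<open>p = 2\<close> their differences are the values of the derivative at the interior
  break points, divided by \<open>M\<close>.
\<close>

section \<open>Cardinal B-splines\<close>

text \<open>Degrees of different parity live on different partitions: the inner break points are
  multiples of 1/M for odd degree and odd multiples of 1/(2M) for even degree. One differentiation
  therefore leaves the family of optimal spaces while two stay inside it, which forces the step of 2
  and two base cases. The even chain starts at 2 because the spline of degree 0 is discontinuous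
  and, on its half-open support, not even symmetric, and because the hat function has no derivative
  at its knots. Oddness of the coefficients encodes the end conditions: with an even B-spline it
  gives a function that is odd about 0 and about M. Integrating twice leaves an affine ambiguity,
  which \<open>s 0 = 0\<close> and \<open>s 1 = 0\<close> remove; the discrete Dirichlet problem for
  the coefficients is solved by the same linear correction. Spanning is surjectivity of the
  coefficient map and independence is its injectivity, each proved by its own induction. M is
  \<open>nel\<close> in the odd case and \<open>nel - 1\<close> in the even case.\<close>

lemma cardinal_bspline_eq_0:
  "t < 0 \<or> real p + 1 \<le> t \<Longrightarrow> cardinal_bspline p t = 0"
proof (induction p arbitrary: t)
  case (Suc p)
  show ?case
  proof (cases "t < 0")
    case True
    then show ?thesis using Suc.IH[of t] Suc.IH[of "t - 1"] by simp
  next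
    case False
    then have t: "real p + 2 \<le> t" using Suc.prems by simp
    then show ?thesis using Suc.IH[of t] Suc.IH[of "t - 1"] by simp
  qed
qed auto

lemma cardinal_bspline_1:
  "cardinal_bspline (Suc 0) t = max 0 t - 2 * max 0 (t - 1) + max 0 (t - 2)"
  by (auto simp: max_def)

text \<open>Truncated powers reduce differentiability at the knots to that of the square of
  \<open>max 0 t\<close> at 0.\<close>

lemma cardinal_bspline_2:
  "cardinal_bspline (Suc (Suc 0)) t =
     ((max 0 t)\<^sup>2 - 3 * (max 0 (t - 1))\<^sup>2 + 3 * (max 0 (t - 2))\<^sup>2 - (max 0 (t - 3))\<^sup>2) / 2"
  unfolding cardinal_bspline.simps(2)[of "Suc 0"] cardinal_bspline_1
  by (auto simp: max_def power2_eq_square field_simps)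

text \<open>Only t = 0 has content; there the difference quotient is bounded by the absolute value
  of h.\<close>

lemma DERIV_max_0_power2: "((\<lambda>t::real. (max 0 t)\<^sup>2) has_real_derivative 2 * max 0 t) (at t)"
proof -
  consider "t < 0" | "t = 0" | "t > 0" by linarith
  then show ?thesis
  proof cases
    case 1
    have "((\<lambda>t::real. 0) has_real_derivative 2 * max 0 t) (at t)"
      using 1 by (auto intro!: derivative_eq_intros)
    then show ?thesis
      by (rule has_field_derivative_transform_within_open[of _ _ _ "{..<0}"]) (use 1 in auto)
  next
    case 3
    have "((\<lambda>t::real. t\<^sup>2) has_real_derivative 2 * max 0 t) (at t)"
      using 3 by (auto intro!: derivative_eq_intros)
    then show ?thesis
      by (rule has_field_derivative_transform_within_open[of _ _ _ "{0<..}"]) (use 3 in auto)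
  next
    case 2
    have "((\<lambda>h::real. (max 0 h)\<^sup>2 / h) \<longlongrightarrow> 0) (at 0)"
    proof (rule Lim_null_comparison)
      show "\<forall>\<^sub>F h in at 0. norm ((max 0 h)\<^sup>2 / h) \<le> \<bar>h::real\<bar>"
        by (auto simp: max_def power2_eq_square)
      show "((\<lambda>h. \<bar>h::real\<bar>) \<longlongrightarrow> 0) (at 0)"
        by (rule tendsto_eq_intros | simp)+
    qed
    then show ?thesis using 2 by (simp add: DERIV_def)
  qed
qed

lemma cardinal_bspline_Suc_mult:
  "(real q + 1) * cardinal_bspline (Suc q) t =
     t * cardinal_bspline q t + (real q + 2 - t) * cardinal_bspline q (t - 1)"
proof -
  have *: "s * (a / s * x + b / s * y) = a * x + b * y" if "s \<noteq> 0" for s a b x y :: real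
    using that by (simp add: distrib_left)
  show ?thesis
    using *[of "real (Suc q)" t "cardinal_bspline q t" "real (Suc q) + 1 - t" "cardinal_bspline q (t - 1)"]
    by (simp add: add_ac)
qed

text \<open>Induction by differentiating the recursion. It starts at the derivative of degree 2, the
  lowest degree that is differentiable at every point.\<close>

lemma DERIV_cardinal_bspline:
  assumes "p \<ge> 1"
  shows "(cardinal_bspline (Suc p) has_real_derivative
           cardinal_bspline p t - cardinal_bspline p (t - 1)) (at t)"
  using assms
proof (induction p arbitrary: t rule: dec_induct)
  case base
  have D: "((\<lambda>t. (max 0 (t - c))\<^sup>2) has_real_derivative 2 * max 0 (t - c)) (at t)" for c t :: real
    using DERIV_max_0_power2[of "t - c"]
      DERIV_shift[of "\<lambda>t. (max 0 t)\<^sup>2" "2 * max 0 (t - c)" t "- c"] by simp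
  have "((\<lambda>t::real. ((max 0 t)\<^sup>2 - 3 * (max 0 (t - 1))\<^sup>2 + 3 * (max 0 (t - 2))\<^sup>2 - (max 0 (t - 3))\<^sup>2) / 2)
      has_real_derivative (2 * max 0 t - 3 * (2 * max 0 (t - 1)) + 3 * (2 * max 0 (t - 2)) - 2 * max 0 (t - 3)) / 2) (at t)"
    by (intro DERIV_cdivide DERIV_diff DERIV_add DERIV_cmult D DERIV_max_0_power2)
  moreover have "(2 * max 0 t - 3 * (2 * max 0 (t - 1)) + 3 * (2 * max 0 (t - 2)) - 2 * max 0 (t - 3)) / 2
      = cardinal_bspline 1 t - cardinal_bspline 1 (t - 1)"
    unfolding One_nat_def cardinal_bspline_1 by (simp add: field_simps)
  ultimately show ?case
    unfolding cardinal_bspline_2[abs_def] One_nat_def by (simp only:)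
next
  case (step q)
  have D: "((\<lambda>t. cardinal_bspline (Suc q) (t - 1)) has_real_derivative
           cardinal_bspline q (t - 1) - cardinal_bspline q (t - 2)) (at t)"
    using step.IH[of "t - 1"]
      DERIV_shift[of "cardinal_bspline (Suc q)" "cardinal_bspline q (t - 1) - cardinal_bspline q (t - 2)" t "- 1"]
    by (simp del: cardinal_bspline.simps)
  have D2: "((\<lambda>t. (t * cardinal_bspline (Suc q) t
             + (real q + 3 - t) * cardinal_bspline (Suc q) (t - 1)) / (real q + 2))
      has_real_derivative
      (1 * cardinal_bspline (Suc q) t + (cardinal_bspline q t - cardinal_bspline q (t - 1)) * t
      + ((0 - 1) * cardinal_bspline (Suc q) (t - 1) +
         (cardinal_bspline q (t - 1) - cardinal_bspline q (t - 2)) * (real q + 3 - t))) / (real q + 2)) (at t)"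
    by (intro DERIV_cdivide DERIV_diff DERIV_add DERIV_mult D step.IH DERIV_ident DERIV_const)
  have recur: "cardinal_bspline (Suc (Suc q)) = (\<lambda>t. (t * cardinal_bspline (Suc q) t
             + (real q + 3 - t) * cardinal_bspline (Suc q) (t - 1)) / (real q + 2))"
    unfolding cardinal_bspline.simps(2)[of "Suc q"] fun_eq_iff
    by (simp add: add_divide_distrib diff_divide_distrib algebra_simps del: cardinal_bspline.simps)
  \<comment> \<open>The splines of degree q regroup into the right-hand sides of the recursion at t
    and at t - 1. They contribute q + 1 copies of the difference, and the product rule contributes
    one more.\<close>
  have "(1 * cardinal_bspline (Suc q) t + (cardinal_bspline q t - cardinal_bspline q (t - 1)) * t
      + ((0 - 1) * cardinal_bspline (Suc q) (t - 1) +
         (cardinal_bspline q (t - 1) - cardinal_bspline q (t - 2)) * (real q + 3 - t)))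
      = (real q + 2) * (cardinal_bspline (Suc q) t - cardinal_bspline (Suc q) (t - 1))"
    using cardinal_bspline_Suc_mult[of q t] cardinal_bspline_Suc_mult[of q "t - 1"]
    by (simp add: algebra_simps del: cardinal_bspline.simps)
  then have "(1 * cardinal_bspline (Suc q) t + (cardinal_bspline q t - cardinal_bspline q (t - 1)) * t
      + ((0 - 1) * cardinal_bspline (Suc q) (t - 1) +
         (cardinal_bspline q (t - 1) - cardinal_bspline q (t - 2)) * (real q + 3 - t))) / (real q + 2)
      = cardinal_bspline (Suc q) t - cardinal_bspline (Suc q) (t - 1)"
    by simp
  with D2 recur show ?case by (simp only:)
qed

text \<open>The reflection swaps the two terms of the recursion. Degree 0 is excluded because its
  half-open support breaks the symmetry at 0 and 1.\<close>

lemma cardinal_bspline_symmetric: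
  assumes "p \<ge> 1"
  shows "cardinal_bspline p (real p + 1 - t) = cardinal_bspline p t"
  using assms
proof (induction p arbitrary: t rule: dec_induct)
  case base
  show ?case by (auto simp: cardinal_bspline_1 max_def)
next
  case (step q)
  have "cardinal_bspline q (real q + 2 - t) = cardinal_bspline q (t - 1)"
    using step.IH[of "t - 1"] by (simp add: algebra_simps)
  moreover have "cardinal_bspline q (real q + 1 - t) = cardinal_bspline q t"
    by (rule step.IH)
  ultimately show ?case
    by (simp add: algebra_simps)
qed

text \<open>Centering turns the symmetry into evenness, so that odd coefficients produce odd
  functions. The price is a shift of the argument by 1/2 with each derivative.\<close>

definition centered_bspline :: "nat \<Rightarrow> real \<Rightarrow> real" where
  "centered_bspline p t = cardinal_bspline p (t + (real p + 1) / 2)"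

text \<open>The left end of the support has argument 0, where the vanishing lemma says nothing;
  reflection moves it to the right end, which that lemma includes.\<close>

lemma centered_bspline_eq_0:
  assumes "p \<ge> 1" "\<bar>t\<bar> \<ge> (real p + 1) / 2"
  shows "centered_bspline p t = 0"
proof (cases "t > 0")
  case True
  then show ?thesis unfolding centered_bspline_def using assms
    by (intro cardinal_bspline_eq_0) (simp add: field_simps)
next
  case False
  have "cardinal_bspline p (real p + 1 - (t + (real p + 1) / 2)) = 0"
    using assms False by (intro cardinal_bspline_eq_0) (simp add: field_simps)
  then show ?thesis unfolding centered_bspline_def cardinal_bspline_symmetric[OF assms(1)] .
qed

lemma centered_bspline_minus:
  assumes "p \<ge> 1"
  shows "centered_bspline p (- t) = centered_bspline p t"
  using cardinal_bspline_symmetric[OF assms, of "t + (real p + 1) / 2"]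
  by (simp add: centered_bspline_def field_simps)

lemma centered_bspline_1: "centered_bspline 1 t = max 0 (1 - \<bar>t\<bar>)"
  unfolding centered_bspline_def One_nat_def cardinal_bspline_1 by (simp add: max_def)

lemma DERIV_centered_bspline:
  assumes "p \<ge> 1"
  shows "(centered_bspline (Suc p) has_real_derivative centered_bspline p (t + 1/2) - centered_bspline p (t - 1/2)) (at t)"
proof -
  have "((\<lambda>t. cardinal_bspline (Suc p) (t + (real p + 2) / 2)) has_real_derivative
      (cardinal_bspline p (t + (real p + 2) / 2) - cardinal_bspline p (t + (real p + 2) / 2 - 1)) * 1) (at t)"
    by (rule DERIV_chain2[OF DERIV_cardinal_bspline[OF assms]]) (auto intro!: derivative_eq_intros)
  moreover have "t + (real p + 2) / 2 = t + 1/2 + (real p + 1) / 2"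
     "t + (real p + 2) / 2 - 1 = t - 1/2 + (real p + 1) / 2" by (simp_all add: field_simps)
  ultimately show ?thesis unfolding centered_bspline_def[abs_def] by (simp add: algebra_simps)
qed

section \<open>Sums of integer translates\<close>

text \<open>The formally infinite series over all integer translates. The index set is finite for p
  at least 1 and does not depend on b, so linearity in b is immediate.\<close>

definition spline_sum :: "nat \<Rightarrow> (int \<Rightarrow> real) \<Rightarrow> real \<Rightarrow> real" where
  "spline_sum p b y = (\<Sum>l | centered_bspline p (y - of_int l) \<noteq> 0. b l * centered_bspline p (y - of_int l))"

lemma centered_bspline_support_subset:
  assumes "p \<ge> 1"
  shows "{l. centered_bspline p (y - of_int l) \<noteq> 0} \<subseteq> {\<lfloor>y\<rfloor> - int p - 1 .. \<lfloor>y\<rfloor> + int p + 1}"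
proof
  fix l assume "l \<in> {l. centered_bspline p (y - of_int l) \<noteq> 0}"
  then have "\<bar>y - of_int l\<bar> < (real p + 1) / 2"
    using centered_bspline_eq_0[OF assms, of "y - of_int l"] by force
  moreover have "(real p + 1) / 2 \<le> real p" using assms by simp
  ultimately have "\<bar>y - of_int l\<bar> < real p" by linarith
  then have "of_int l < of_int (\<lfloor>y\<rfloor> + int p + 1) + (0::real)" "of_int (\<lfloor>y\<rfloor> - int p) < of_int l + (1::real)"
    by linarith+
  then show "l \<in> {\<lfloor>y\<rfloor> - int p - 1 .. \<lfloor>y\<rfloor> + int p + 1}" by simp
qed

lemma spline_sum_eq:
  assumes "finite A" "{l. centered_bspline p (y - of_int l) \<noteq> 0} \<subseteq> A"
  shows "spline_sum p b y = (\<Sum>l\<in>A. b l * centered_bspline p (y - of_int l))"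
  unfolding spline_sum_def using assms by (intro sum.mono_neutral_left) auto

lemma spline_sum_shift: "spline_sum p (\<lambda>l. b (l + k)) y = spline_sum p b (y + of_int k)"
  unfolding spline_sum_def
  by (rule sum.reindex_bij_witness[of _ "\<lambda>l. l - k" "\<lambda>l. l + k"]) (auto simp: algebra_simps)

lemma spline_sum_reflect:
  assumes "p \<ge> 1"
  shows "spline_sum p (\<lambda>l. b (k - l)) y = spline_sum p b (of_int k - y)"
proof -
  have *: "centered_bspline p (of_int k - y - of_int l) = centered_bspline p (y - of_int (k - l))" for l
    using centered_bspline_minus[OF assms, of "y - of_int (k - l)"] by (simp add: algebra_simps)
  show ?thesis
    unfolding spline_sum_def *
    by (rule sum.reindex_bij_witness[of _ "\<lambda>l. k - l" "\<lambda>l. k - l"]) auto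
qed

lemma spline_sum_sum:
  "spline_sum p (\<lambda>l. \<Sum>r\<in>R. a r * c r l) y = (\<Sum>r\<in>R. a r * spline_sum p (c r) y)"
  unfolding spline_sum_def sum_distrib_left sum_distrib_right
  by (subst sum.swap) (simp add: mult.assoc)

lemma spline_sum_diff: "spline_sum p (\<lambda>l. b l - c l) y = spline_sum p b y - spline_sum p c y"
  unfolding spline_sum_def by (simp add: sum_subtractf algebra_simps)

lemma spline_sum_cmult: "spline_sum p (\<lambda>l. d * b l) y = d * spline_sum p b y"
  unfolding spline_sum_def by (simp add: sum_distrib_left algebra_simps)

lemma spline_sum_uminus: "spline_sum p (\<lambda>l. - b l) y = - spline_sum p b y"
  unfolding spline_sum_def by (simp add: sum_negf)

lemma DERIV_spline_sum:
  assumes "p \<ge> 1"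
  shows "(spline_sum (Suc p) b has_real_derivative
           spline_sum p b (y + 1/2) - spline_sum p b (y - 1/2)) (at y)"
proof -
  \<comment> \<open>The index set of \<open>spline_sum\<close> varies with the point, so one window
    must serve all points at distance below 1 from y and both degrees. A margin of 3 would do: one
    each for the degree, the move of the floor and the support bound.\<close>
  define A where "A = {\<lfloor>y\<rfloor> - int p - 5 .. \<lfloor>y\<rfloor> + int p + 5}"
  have "finite A" by (simp add: A_def)
  have sub: "{l. centered_bspline q (x - of_int l) \<noteq> 0} \<subseteq> A" if "q \<ge> 1" "q \<le> Suc p" "\<bar>x - y\<bar> < 1" for q x
  proof -
    have "\<lfloor>y\<rfloor> - 1 \<le> \<lfloor>x\<rfloor>" "\<lfloor>x\<rfloor> \<le> \<lfloor>y\<rfloor> + 1" using that by linarith+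
    then show ?thesis using centered_bspline_support_subset[OF that(1), of x] that(2) unfolding A_def by force
  qed
  have D: "((\<lambda>x. centered_bspline (Suc p) (x - of_int l)) has_real_derivative
      centered_bspline p (y - of_int l + 1/2) - centered_bspline p (y - of_int l - 1/2)) (at y)" for l
    using DERIV_centered_bspline[OF assms, of "y - of_int l"] DERIV_shift[of "centered_bspline (Suc p)" _ y "- of_int l"] by simp
  have "((\<lambda>x. \<Sum>l\<in>A. b l * centered_bspline (Suc p) (x - of_int l)) has_real_derivative
      (\<Sum>l\<in>A. b l * (centered_bspline p (y - of_int l + 1/2) - centered_bspline p (y - of_int l - 1/2)))) (at y)"
    by (intro DERIV_sum DERIV_cmult D)
  also have "(\<Sum>l\<in>A. b l * (centered_bspline p (y - of_int l + 1/2) - centered_bspline p (y - of_int l - 1/2))) =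
      (\<Sum>l\<in>A. b l * centered_bspline p ((y + 1/2) - of_int l)) - (\<Sum>l\<in>A. b l * centered_bspline p ((y - 1/2) - of_int l))"
    by (simp add: sum_subtractf algebra_simps)
  also have "\<dots> = spline_sum p b (y + 1/2) - spline_sum p b (y - 1/2)"
    using spline_sum_eq[OF \<open>finite A\<close> sub] assms by simp
  finally show ?thesis
  proof (rule has_field_derivative_transform_within_open[of _ _ _ "ball y 1"])
    fix x assume "x \<in> ball y 1"
    then have "\<bar>x - y\<bar> < 1" by (simp add: dist_real_def)
    then show "(\<Sum>l\<in>A. b l * centered_bspline (Suc p) (x - of_int l)) = spline_sum (Suc p) b x"
      using spline_sum_eq[OF \<open>finite A\<close> sub] by simp
  qed auto
qed

text \<open>Hat functions interpolate b linearly at the integers. The interval is closed at both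
  ends, so either neighbouring formula may be used at an integer.\<close>

lemma spline_sum_1:
  assumes "of_int j \<le> y" "y \<le> of_int j + 1"
  shows "spline_sum 1 b y = b j * (of_int j + 1 - y) + b (j + 1) * (y - of_int j)"
proof -
  have "spline_sum 1 b y = (\<Sum>l\<in>{j, j + 1}. b l * centered_bspline 1 (y - of_int l))"
  proof (rule spline_sum_eq)
    show "{l. centered_bspline 1 (y - of_int l) \<noteq> 0} \<subseteq> {j, j + 1}"
    proof
      fix l assume "l \<in> {l. centered_bspline 1 (y - of_int l) \<noteq> 0}"
      then have "\<bar>y - of_int l\<bar> < 1" using centered_bspline_eq_0[of 1 "y - of_int l"] by force
      then have "j - 1 < l" "l < j + 2" using assms by linarith+
      then show "l \<in> {j, j + 1}" by auto
    qed
  qed simp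
  also have "\<dots> = b j * (of_int j + 1 - y) + b (j + 1) * (y - of_int j)"
    using assms by (simp add: centered_bspline_1[unfolded One_nat_def] max_def abs_if algebra_simps)
  finally show ?thesis .
qed

text \<open>Degree 1 lies below the range of the derivative formula, so continuity is obtained from
  a locally fixed finite index window.\<close>

lemma continuous_on_spline_sum_1: "continuous_on S (spline_sum 1 b)"
proof (rule continuous_on_subset[OF _ subset_UNIV], unfold continuous_on_eq_continuous_at[OF open_UNIV], intro ballI)
  fix y :: real
  define A where "A = {\<lfloor>y\<rfloor> - 5 .. \<lfloor>y\<rfloor> + 5}"
  have "continuous_on (ball y 1) (\<lambda>x. \<Sum>l\<in>A. b l * centered_bspline 1 (x - of_int l))"
    unfolding centered_bspline_1 by (intro continuous_intros)
  moreover have "(\<Sum>l\<in>A. b l * centered_bspline 1 (x - of_int l)) = spline_sum 1 b x" if "x \<in> ball y 1" for x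
  proof (rule spline_sum_eq[symmetric])
    have "\<bar>x - y\<bar> < 1" using that by (simp add: dist_real_def)
    then have "\<lfloor>y\<rfloor> - 1 \<le> \<lfloor>x\<rfloor>" "\<lfloor>x\<rfloor> \<le> \<lfloor>y\<rfloor> + 1" by linarith+
    then show "{l. centered_bspline 1 (x - of_int l) \<noteq> 0} \<subseteq> A"
      using centered_bspline_support_subset[of 1 x] unfolding A_def by force
  qed (simp add: A_def)
  ultimately have "continuous_on (ball y 1) (spline_sum 1 b)"
    by (metis (no_types, lifting) continuous_on_cong)
  then show "isCont (spline_sum 1 b) y"
    by (simp add: continuous_on_eq_continuous_at)
qed

section \<open>Odd periodic coefficient sequences\<close>

definition odd_periodic :: "nat \<Rightarrow> (int \<Rightarrow> real) \<Rightarrow> bool" where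
  "odd_periodic M b \<longleftrightarrow> (\<forall>l. b (- l) = - b l) \<and> (\<forall>l. b (l + 2 * int M) = b l)"

lemma odd_periodic_minus: "odd_periodic M b \<Longrightarrow> b (- l) = - b l"
  by (simp add: odd_periodic_def)

lemma odd_periodic_add: "odd_periodic M b \<Longrightarrow> b (l + 2 * int M) = b l"
  by (simp add: odd_periodic_def)

lemma odd_periodic_reflect: "odd_periodic M b \<Longrightarrow> b (2 * int M - l) = - b l"
  using odd_periodic_add[of M b "- l"] odd_periodic_minus[of M b l] by (simp add: algebra_simps)

lemma odd_periodic_0: "odd_periodic M b \<Longrightarrow> b 0 = 0"
  using odd_periodic_minus[of M b 0] by simp

lemma odd_periodic_M: "odd_periodic M b \<Longrightarrow> b (int M) = 0"
  using odd_periodic_reflect[of M b "int M"] by simp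

lemma odd_periodic_mod:
  assumes "odd_periodic M b"
  shows "b (l mod (2 * int M)) = b l"
proof -
  have nat: "b (l + int n * (2 * int M)) = b l" for l n
  proof (induction n)
    case (Suc n)
    have "b (l + int (Suc n) * (2 * int M)) = b (l + int n * (2 * int M) + 2 * int M)"
      by (simp add: algebra_simps)
    then show ?case using Suc odd_periodic_add[OF assms] by simp
  qed simp
  have "b (l + k * (2 * int M)) = b l" for k
  proof (cases "k \<ge> 0")
    case True
    then show ?thesis using nat[of l "nat k"] by simp
  next
    case False
    then show ?thesis using nat[of "l + k * (2 * int M)" "nat (- k)"] by simp
  qed
  from this[of "- (l div (2 * int M))"] show ?thesis
    by (simp add: minus_div_mult_eq_mod[symmetric])
qed

text \<open>Reduction modulo 2M and the reflection about M bring every index into the range from 0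
  to M, whose two ends vanish by oddness.\<close>

lemma odd_periodic_zeroI:
  assumes b: "odd_periodic M b" and M: "M \<ge> 1" and z: "\<And>r. r \<in> {1..M - 1} \<Longrightarrow> b (int r) = 0"
  shows "b l = 0"
proof -
  define m where "m = l mod (2 * int M)"
  have m: "0 \<le> m" "m < 2 * int M" unfolding m_def using M by simp_all
  have z': "b k = 0" if "0 \<le> k" "k \<le> int M" for k
  proof -
    define n where "n = nat k"
    then have n: "k = int n" using that(1) by simp
    then have "n = 0 \<or> n = M \<or> n \<in> {1..M - 1}" using that(2) by auto
    then show ?thesis using n odd_periodic_0[OF b] odd_periodic_M[OF b] z[of n] by (metis of_nat_0)
  qed
  have "b m = 0"
  proof (cases "m \<le> int M")
    case True
    with m(1) show ?thesis by (rule z')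
  next
    case False
    then have "b (2 * int M - m) = 0" using m by (intro z') auto
    then show ?thesis using odd_periodic_reflect[OF b, of m] by simp
  qed
  then show ?thesis unfolding m_def odd_periodic_mod[OF b] .
qed

section \<open>The unit vectors among the odd periodic sequences\<close>

text \<open>For r between 1 and M - 1 this is the odd 2M-periodic continuation of the r-th unit
  vector: a comb through r minus the comb through -r.\<close>

definition odd_delta :: "nat \<Rightarrow> nat \<Rightarrow> int \<Rightarrow> real" where
  "odd_delta M r l = (if 2 * int M dvd l - int r then 1 else 0) - (if 2 * int M dvd l + int r then 1 else 0)"

lemma odd_periodic_odd_delta: "odd_periodic M (odd_delta M r)"
proof -
  have "2 * int M dvd - l - int r \<longleftrightarrow> 2 * int M dvd l + int r"
    "2 * int M dvd - l + int r \<longleftrightarrow> 2 * int M dvd l - int r" for l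
    using dvd_minus_iff[of "2 * int M" "l + int r"] dvd_minus_iff[of "2 * int M" "l - int r"]
    by (simp_all add: algebra_simps)
  moreover have "2 * int M dvd l + 2 * int M - int r \<longleftrightarrow> 2 * int M dvd l - int r"
    "2 * int M dvd l + 2 * int M + int r \<longleftrightarrow> 2 * int M dvd l + int r" for l
    using dvd_add_left_iff[of "2 * int M" "2 * int M" "l - int r"]
      dvd_add_left_iff[of "2 * int M" "2 * int M" "l + int r"]
    by (simp_all add: algebra_simps)
  ultimately show ?thesis unfolding odd_periodic_def odd_delta_def by simp
qed

lemma odd_periodic_diff:
  "odd_periodic M b \<Longrightarrow> odd_periodic M c \<Longrightarrow> odd_periodic M (\<lambda>l. b l - c l)"
  by (simp add: odd_periodic_def)

lemma odd_periodic_cmult: "odd_periodic M b \<Longrightarrow> odd_periodic M (\<lambda>l. d * b l)"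
  by (simp add: odd_periodic_def)

lemma odd_periodic_sum:
  "(\<And>r. r \<in> R \<Longrightarrow> odd_periodic M (c r)) \<Longrightarrow> odd_periodic M (\<lambda>l. \<Sum>r\<in>R. a r * c r l)"
  by (simp add: odd_periodic_def sum_negf)

lemma odd_delta_delta:
  assumes "r \<in> {1..M - 1}" "k \<in> {1..M - 1}"
  shows "odd_delta M r (int k) = (if k = r then 1 else 0)"
proof -
  have "\<not> 2 * int M dvd int k - int r" if "k \<noteq> r"
  proof
    assume "2 * int M dvd int k - int r"
    moreover have "int k - int r \<noteq> 0" using that by simp
    ultimately have "\<bar>2 * int M\<bar> \<le> \<bar>int k - int r\<bar>" by (intro dvd_imp_le_int)
    then show False using assms by auto
  qed
  then have "2 * int M dvd int k - int r \<longleftrightarrow> k = r" by auto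
  moreover have "\<not> 2 * int M dvd int k + int r"
  proof
    assume "2 * int M dvd int k + int r"
    then have "2 * int M \<le> int k + int r" using assms by (intro zdvd_imp_le) auto
    then show False using assms by auto
  qed
  ultimately show ?thesis by (simp add: odd_delta_def)
qed

lemma sum_odd_delta_nat:
  assumes "k \<in> {1..M - 1}"
  shows "(\<Sum>r\<in>{1..M - 1}. f r * odd_delta M r (int k)) = f k"
proof -
  have "(\<Sum>r\<in>{1..M - 1}. f r * odd_delta M r (int k)) = (\<Sum>r\<in>{1..M - 1}. if k = r then f r else 0)"
    by (rule sum.cong) (auto simp: odd_delta_delta[OF _ assms])
  then show ?thesis using assms by simp
qed

lemma odd_periodic_eq_sum:
  assumes "odd_periodic M b" "M \<ge> 1"
  shows "b = (\<lambda>l. \<Sum>r\<in>{1..M - 1}. b (int r) * odd_delta M r l)"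
proof
  fix l
  have "b l - (\<Sum>r\<in>{1..M - 1}. b (int r) * odd_delta M r l) = 0"
    by (rule odd_periodic_zeroI[OF odd_periodic_diff[OF assms(1) odd_periodic_sum] assms(2)])
      (simp_all add: odd_periodic_odd_delta sum_odd_delta_nat[simplified])
  then show "b l = (\<Sum>r\<in>{1..M - 1}. b (int r) * odd_delta M r l)" by simp
qed

text \<open>Prescribed values at 0 and M must be zero, since every odd 2M-periodic sequence vanishes
  there.\<close>

lemma odd_periodic_extension:
  assumes "M \<ge> 1" "f 0 = 0" "f M = 0"
  obtains b where "odd_periodic M b" "\<And>r. r \<le> M \<Longrightarrow> b (int r) = f r"
proof
  let ?b = "\<lambda>l. \<Sum>r\<in>{1..M - 1}. f r * odd_delta M r l"
  show b: "odd_periodic M ?b" by (intro odd_periodic_sum odd_periodic_odd_delta)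
  show "?b (int r) = f r" if "r \<le> M" for r
  proof -
    consider "r = 0" | "r = M" | "r \<in> {1..M - 1}" using \<open>r \<le> M\<close> by force
    then show ?thesis
      using odd_periodic_0[OF b] odd_periodic_M[OF b] assms sum_odd_delta_nat[of r M f]
      by cases simp_all
  qed
qed

section \<open>The discrete Dirichlet problem for the second difference\<close>

definition second_diff :: "(int \<Rightarrow> real) \<Rightarrow> int \<Rightarrow> real" where
  "second_diff b l = b (l + 1) - 2 * b l + b (l - 1)"

lemma odd_periodic_second_diff:
  assumes "odd_periodic M b"
  shows "odd_periodic M (second_diff b)"
  unfolding odd_periodic_def
proof (intro conjI allI)
  fix l
  show "second_diff b (- l) = - second_diff b l"
    using odd_periodic_minus[OF assms, of "l - 1"] odd_periodic_minus[OF assms, of "l + 1"]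
      odd_periodic_minus[OF assms, of l] by (simp add: second_diff_def)
  show "second_diff b (l + 2 * int M) = second_diff b l"
    using odd_periodic_add[OF assms, of "l - 1"] odd_periodic_add[OF assms, of "l + 1"]
      odd_periodic_add[OF assms, of l] by (simp add: second_diff_def algebra_simps)
qed

lemma second_diff_surj:
  assumes a: "odd_periodic M a" and M: "M \<ge> 1"
  obtains b where "odd_periodic M b" "second_diff b = a"
proof -
  \<comment> \<open>Twofold summation of a, the discrete analogue of Cauchy's formula for repeated
    integration: the second difference of B at n + 1 is a at n + 1.\<close>
  define B where "B n = (\<Sum>k<n. real (n - k) * a (int k))" for n
  have B_Suc: "B (Suc n) = B n + (\<Sum>k\<le>n. a (int k))" for n
  proof -
    have "B (Suc n) = (\<Sum>k\<le>n. real (Suc n - k) * a (int k))" by (simp add: B_def lessThan_Suc_atMost)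
    also have "\<dots> = (\<Sum>k\<le>n. real (n - k) * a (int k) + a (int k))"
      by (rule sum.cong) (auto simp: Suc_diff_le algebra_simps)
    also have "\<dots> = (\<Sum>k\<le>n. real (n - k) * a (int k)) + (\<Sum>k\<le>n. a (int k))" by (rule sum.distrib)
    also have "(\<Sum>k\<le>n. real (n - k) * a (int k)) = B n"
      unfolding B_def lessThan_Suc_atMost[symmetric] by simp
    finally show ?thesis .
  qed
  \<comment> \<open>The linear term leaves second differences unchanged and makes f vanish at M, as
    an odd periodic extension requires.\<close>
  define f where "f r = B r - real r * B M / real M" for r
  obtain b where b: "odd_periodic M b" "\<And>r. r \<le> M \<Longrightarrow> b (int r) = f r"
    using M by (rule odd_periodic_extension[of M f]) (simp_all add: f_def B_def)
  have "second_diff b l - a l = 0" for l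
  proof (rule odd_periodic_zeroI[OF odd_periodic_diff[OF odd_periodic_second_diff[OF b(1)] a] M])
    fix r assume r: "r \<in> {1..M - 1}"
    then obtain q where q: "r = Suc q" by (cases r) auto
    have "second_diff b (int r) = f (Suc (Suc q)) - 2 * f (Suc q) + f q"
      using b(2)[of "Suc (Suc q)"] b(2)[of "Suc q"] b(2)[of q] r q
      by (simp add: second_diff_def algebra_simps)
    also have "\<dots> = a (int r)"
      unfolding f_def B_Suc using M by (simp add: q field_simps)
    finally show "second_diff b (int r) - a (int r) = 0" by simp
  qed
  then have "second_diff b = a" by (simp add: fun_eq_iff)
  with b(1) show ?thesis by (rule that)
qed

lemma second_diff_inj:
  assumes b: "odd_periodic M b" and M: "M \<ge> 1" and z: "\<And>l. second_diff b l = 0"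
  shows "b l = 0"
proof -
  \<comment> \<open>The recurrence has order two, so two consecutive values are carried. Linear
    growth together with \<open>b (int M) = 0\<close> then forces \<open>b 1 = 0\<close>.\<close>
  have lin: "b (int n) = real n * b 1 \<and> b (int (Suc n)) = real (Suc n) * b 1" for n
  proof (induction n)
    case 0
    then show ?case using odd_periodic_0[OF b] by simp
  next
    case (Suc n)
    then show ?case using z[of "int (Suc n)"] by (simp add: second_diff_def algebra_simps)
  qed
  have "real M * b 1 = 0" using lin[of M] odd_periodic_M[OF b] by simp
  then have "b 1 = 0" using M by simp
  then have "b (int n) = 0" for n using lin[of n] by simp
  then show ?thesis by (rule odd_periodic_zeroI[OF b M])
qed

section \<open>Splines on the unit interval\<close>

text \<open>A relation rather than a function: g is determined only on [0,1], and this leaves the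
  choice of a convenient representative outside it.\<close>

definition has_deriv01 :: "(real \<Rightarrow> real) \<Rightarrow> (real \<Rightarrow> real) \<Rightarrow> bool" where
  "has_deriv01 s g \<longleftrightarrow> (\<forall>x\<in>{0..1}. (s has_real_derivative g x) (at x within {0..1}))"

lemma has_field_derivative_unique_Icc:
  fixes f :: "real \<Rightarrow> real"
  assumes "a < b" "x \<in> {a..b}"
    "(f has_real_derivative d) (at x within {a..b})" "(f has_real_derivative e) (at x within {a..b})"
  shows "d = e"
  using vector_derivative_unique_within_closed_interval[of a b x f d e] assms
  by (simp add: has_real_derivative_iff_has_vector_derivative)

lemma has_field_derivative_cong_on:
  fixes f g :: "real \<Rightarrow> real"
  assumes "x \<in> S" "\<And>x. x \<in> S \<Longrightarrow> f x = g x" "(f has_real_derivative d) (at x within S)"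
  shows "(g has_real_derivative d) (at x within S)"
  using has_vector_derivative_transform[of x S g f d] assms
  by (simp add: has_real_derivative_iff_has_vector_derivative)

lemma has_deriv01_cong:
  assumes "\<And>x. x \<in> {0..1} \<Longrightarrow> s x = t x" "\<And>x. x \<in> {0..1} \<Longrightarrow> g x = h x" "has_deriv01 s g"
  shows "has_deriv01 t h"
  unfolding has_deriv01_def
proof
  fix x :: real assume x: "x \<in> {0..1}"
  show "(t has_real_derivative h x) (at x within {0..1})"
    using assms(3) x by (intro has_field_derivative_cong_on[OF x assms(1)])
      (auto simp: has_deriv01_def assms(2)[OF x, symmetric])
qed

lemma has_deriv01_diff:
  "has_deriv01 s g \<Longrightarrow> has_deriv01 t h \<Longrightarrow> has_deriv01 (\<lambda>x. s x - t x) (\<lambda>x. g x - h x)"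
  by (simp add: has_deriv01_def DERIV_diff)

lemma has_deriv01_unique:
  assumes "has_deriv01 s g" "has_deriv01 s h" "x \<in> {0..1}"
  shows "g x = h x"
  using has_field_derivative_unique_Icc[of 0 1 x s] assms by (auto simp: has_deriv01_def)

text \<open>An affine function with two zeros vanishes. This removes both integration constants when
  a spline is recovered from its derivatives.\<close>

lemma has_deriv01_const_imp_0:
  assumes D: "has_deriv01 e (\<lambda>x. D)" and "e 0 = 0" "e 1 = 0" "x \<in> {0..1}"
  shows "e x = 0"
proof -
  have "((\<lambda>x. e x - D * x) has_real_derivative 0) (at x within {0..1})" if "x \<in> {0..1}" for x
    using D that by (auto simp: has_deriv01_def intro!: derivative_eq_intros)
  then obtain c where c: "\<And>x. x \<in> {0..1} \<Longrightarrow> e x - D * x = c"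
    using has_field_derivative_zero_constant[of "{0..1::real}" "\<lambda>x. e x - D * x"] by auto
  show ?thesis using c[of 0] c[of 1] c[of x] assms(2-4) by simp
qed

lemma deriv01_0 [simp]: "deriv01 0 s = s"
  by (simp add: deriv01_def)

text \<open>The innermost derivative is split off, to match inductions that pass from s to its
  derivative.\<close>

lemma deriv01_Suc: "deriv01 (Suc k) s = deriv01 k (deriv01 1 s)"
  by (simp add: deriv01_def funpow_Suc_right del: funpow.simps(2))

lemma deriv01_1_eqI:
  "(s has_real_derivative d) (at x within {0..1}) \<Longrightarrow> x \<in> {0..1} \<Longrightarrow> deriv01 1 s x = d"
  using vector_derivative_within_closed_interval[of 0 1 x s d]
  by (simp add: deriv01_def has_real_derivative_iff_has_vector_derivative)

lemma deriv01_1_eq: "has_deriv01 s g \<Longrightarrow> x \<in> {0..1} \<Longrightarrow> deriv01 1 s x = g x"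
  unfolding has_deriv01_def using deriv01_1_eqI by blast

lemma has_deriv01_deriv01:
  assumes "s differentiable_on {0..1}"
  shows "has_deriv01 s (deriv01 1 s)"
proof -
  have "\<exists>d. (s has_real_derivative d) (at x within {0..1})" if "x \<in> {0..1}" for x
    using assms that by (simp add: differentiable_on_def real_differentiable_def)
  then show ?thesis
    unfolding has_deriv01_def using deriv01_1_eqI by metis
qed

lemma has_deriv01_differentiable_on: "has_deriv01 s g \<Longrightarrow> s differentiable_on {0..1}"
  by (auto simp: has_deriv01_def differentiable_on_def real_differentiable_def)

lemma deriv01_cong:
  assumes "\<And>x. x \<in> {0..1} \<Longrightarrow> s x = t x" "x \<in> {0..1}"
  shows "deriv01 k s x = deriv01 k t x"
  using assms
proof (induction k arbitrary: s t x)
  case (Suc k)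
  have "deriv01 1 s x = deriv01 1 t x" if x: "x \<in> {0..1}" for x
  proof -
    \<comment> \<open>Equivalence for every d makes the choice inside
      \<open>vector_derivative\<close> agree even where no derivative exists.\<close>
    have "(s has_vector_derivative d) (at x within {0..1}) \<longleftrightarrow> (t has_vector_derivative d) (at x within {0..1})" for d
      using has_vector_derivative_transform[OF x, of s t d] has_vector_derivative_transform[OF x, of t s d]
        Suc.prems(1) by auto
    then show ?thesis by (simp add: deriv01_def vector_derivative_def)
  qed
  from Suc.IH[OF this Suc.prems(2)] show ?case by (simp only: deriv01_Suc)
qed simp

lemma differentiable_on_cong01:
  assumes "\<And>x. x \<in> {0..1} \<Longrightarrow> s x = t x" "s differentiable_on {0..1::real}"
  shows "t differentiable_on {0..1::real}"
  using assms differentiable_transform_within[of s _ "{0..1}" 1 t] by (auto simp: differentiable_on_def)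

lemma C01_cong:
  assumes "\<And>x. x \<in> {0..1} \<Longrightarrow> s x = t x" "s \<in> C01 k"
  shows "t \<in> C01 k"
proof -
  have eq: "deriv01 j s x = deriv01 j t x" if "x \<in> {0..1}" for x j
    using deriv01_cong assms(1) that by blast
  have "deriv01 j t differentiable_on {0..1}" if "j < k" for j
    using assms(2) that by (intro differentiable_on_cong01[OF eq]) (auto simp: C01_def)
  moreover have "continuous_on {0..1} (deriv01 k t)"
    using assms(2) continuous_on_cong[OF refl, of "{0..1}" "deriv01 k s" "deriv01 k t"] eq
    by (simp add: C01_def)
  ultimately show ?thesis by (simp add: C01_def)
qed

lemma C01_Suc_iff: "s \<in> C01 (Suc k) \<longleftrightarrow> s differentiable_on {0..1} \<and> deriv01 1 s \<in> C01 k"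
  by (simp only: C01_def mem_Collect_eq All_less_Suc2 deriv01_0 deriv01_Suc conj_assoc)

lemma C01_Suc_has_deriv01:
  assumes "has_deriv01 s g"
  shows "s \<in> C01 (Suc k) \<longleftrightarrow> g \<in> C01 k"
  using C01_cong[of "deriv01 1 s" g k] C01_cong[of g "deriv01 1 s" k] deriv01_1_eq[OF assms]
    has_deriv01_differentiable_on[OF assms]
  by (auto simp: C01_Suc_iff)

section \<open>Piecewise polynomials under differentiation and integration\<close>

lemma pderiv_surj:
  fixes q :: "real poly"
  obtains Q where "pderiv Q = q" "degree Q \<le> Suc (degree q)"
proof
  let ?Q = "\<Sum>i\<le>degree q. monom (coeff q i / real (Suc i)) (Suc i)"
  have "pderiv ?Q = (\<Sum>i\<le>degree q. monom (coeff q i) i)"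
    by (simp add: higher_pderiv_sum[of 1, simplified] pderiv_monom)
  then show "pderiv ?Q = q" by (simp add: poly_as_sum_of_monoms)
  show "degree ?Q \<le> Suc (degree q)"
    by (intro degree_sum_le) (auto intro: order_trans[OF degree_monom_le])
qed

text \<open>The polynomial clause of \<open>spline_space\<close>, isolated because it passes to the
  derivative by a different argument than the smoothness clause.\<close>

definition piecewise_poly :: "nat \<Rightarrow> real list \<Rightarrow> (real \<Rightarrow> real) \<Rightarrow> bool" where
  "piecewise_poly d \<tau> s \<longleftrightarrow> (\<forall>j < length \<tau> - 1. \<exists>q::real poly. degree q \<le> d \<and>
     (\<forall>x \<in> {\<tau> ! j .. \<tau> ! (j + 1)}. s x = poly q x))"

text \<open>Strict increase makes every element nondegenerate, so that derivatives within a single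
  element are unique.\<close>

definition breaks01 :: "real list \<Rightarrow> bool" where
  "breaks01 \<tau> \<longleftrightarrow> (\<forall>j < length \<tau> - 1. 0 \<le> \<tau> ! j \<and> \<tau> ! j < \<tau> ! (j + 1) \<and> \<tau> ! (j + 1) \<le> 1)"

text \<open>From left to right, differentiate the polynomial; from right to left, a polynomial
  antiderivative differs from s by a constant on the interval.\<close>

lemma poly_piece_deriv_iff:
  fixes s g :: "real \<Rightarrow> real"
  assumes "a < b" and D: "\<And>x. x \<in> {a..b} \<Longrightarrow> (s has_real_derivative g x) (at x within {a..b})"
  shows "(\<exists>q. degree q \<le> Suc d \<and> (\<forall>x\<in>{a..b}. s x = poly q x)) \<longleftrightarrow>
         (\<exists>q. degree q \<le> d \<and> (\<forall>x\<in>{a..b}. g x = poly q x))" (is "?L \<longleftrightarrow> ?R")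
proof
  assume ?L
  then obtain q where q: "degree q \<le> Suc d" "\<And>x. x \<in> {a..b} \<Longrightarrow> s x = poly q x" by auto
  have "g x = poly (pderiv q) x" if x: "x \<in> {a..b}" for x
  proof (rule has_field_derivative_unique_Icc[OF assms(1) x])
    show "(poly q has_real_derivative g x) (at x within {a..b})"
      using has_field_derivative_cong_on[OF x q(2) D[OF x]] by auto
    show "(poly q has_real_derivative poly (pderiv q) x) (at x within {a..b})"
      using poly_DERIV has_field_derivative_at_within by blast
  qed
  moreover have "degree (pderiv q) \<le> d" using q(1) by (simp add: degree_pderiv)
  ultimately show ?R by blast
next
  assume ?R
  then obtain q where q: "degree q \<le> d" "\<And>x. x \<in> {a..b} \<Longrightarrow> g x = poly q x" by auto
  obtain Q where Q: "pderiv Q = q" "degree Q \<le> Suc (degree q)" by (rule pderiv_surj)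
  have "((\<lambda>x. s x - poly Q x) has_real_derivative 0) (at x within {a..b})" if x: "x \<in> {a..b}" for x
    using DERIV_diff[OF D[OF x] has_field_derivative_at_within[OF poly_DERIV[of Q x]]] Q(1) q(2)[OF x] by simp
  then obtain c where c: "\<And>x. x \<in> {a..b} \<Longrightarrow> s x - poly Q x = c"
    using has_field_derivative_zero_constant[of "{a..b}" "\<lambda>x. s x - poly Q x"] by auto
  have "s x = poly (Q + [:c:]) x" if "x \<in> {a..b}" for x
    using c[OF that] by simp
  moreover have "degree (Q + [:c:]) \<le> Suc d"
    using Q(2) q(1) by (intro degree_add_le) auto
  ultimately show ?L by blast
qed

lemma piecewise_poly_Suc_iff:
  assumes "breaks01 \<tau>" "has_deriv01 s g"
  shows "piecewise_poly (Suc d) \<tau> s \<longleftrightarrow> piecewise_poly d \<tau> g"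
  unfolding piecewise_poly_def
proof (intro all_cong imp_cong refl)
  fix j assume "j < length \<tau> - 1"
  then have j: "0 \<le> \<tau> ! j" "\<tau> ! j < \<tau> ! (j + 1)" "\<tau> ! (j + 1) \<le> 1"
    using assms(1) by (auto simp: breaks01_def)
  then have sub: "{\<tau> ! j..\<tau> ! (j + 1)} \<subseteq> {0..1}" by auto
  have "(s has_real_derivative g x) (at x within {\<tau> ! j..\<tau> ! (j + 1)})"
    if "x \<in> {\<tau> ! j..\<tau> ! (j + 1)}" for x
    using assms(2) that sub DERIV_subset[OF _ sub] unfolding has_deriv01_def by blast
  from poly_piece_deriv_iff[OF j(2) this]
  show "(\<exists>q. degree q \<le> Suc d \<and> (\<forall>x\<in>{\<tau> ! j..\<tau> ! (j + 1)}. s x = poly q x)) \<longleftrightarrow>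
         (\<exists>q. degree q \<le> d \<and> (\<forall>x\<in>{\<tau> ! j..\<tau> ! (j + 1)}. g x = poly q x))" .
qed

lemma piecewise_poly_cong:
  assumes "breaks01 \<tau>" "\<And>x. x \<in> {0..1} \<Longrightarrow> s x = t x" "piecewise_poly d \<tau> s"
  shows "piecewise_poly d \<tau> t"
  unfolding piecewise_poly_def
proof (intro allI impI)
  fix j assume j: "j < length \<tau> - 1"
  then obtain q where q: "degree q \<le> d" "\<forall>x \<in> {\<tau> ! j .. \<tau> ! (j + 1)}. s x = poly q x"
    using assms(3) unfolding piecewise_poly_def by blast
  have "{\<tau> ! j..\<tau> ! (j + 1)} \<subseteq> {0..1}"
    using assms(1) j by (force simp: breaks01_def)
  then have "\<forall>x \<in> {\<tau> ! j .. \<tau> ! (j + 1)}. t x = poly q x" using q(2) assms(2) by force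
  then show "\<exists>q. degree q \<le> d \<and> (\<forall>x \<in> {\<tau> ! j .. \<tau> ! (j + 1)}. t x = poly q x)"
    using q(1) by blast
qed

section \<open>Spline spaces and optimal spaces under differentiation\<close>

lemma spline_space_iff:
  "s \<in> spline_space p \<tau> \<longleftrightarrow>
     s \<in> C01 (p - 1) \<and> (\<forall>x. x \<notin> {0..1} \<longrightarrow> s x = 0) \<and> piecewise_poly p \<tau> s"
  by (simp add: spline_space_def piecewise_poly_def)

lemma restrict01_eq: "x \<in> {0..1} \<Longrightarrow> restrict01 f x = f x"
  by (simp add: restrict01_def)

lemma restrict01_eq_0: "x \<notin> {0..1} \<Longrightarrow> restrict01 f x = 0"
  by (auto simp: restrict01_def)

lemma spline_space_Suc_iff:
  assumes "p \<ge> 1" "breaks01 \<tau>"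
  shows "s \<in> spline_space (Suc p) \<tau> \<longleftrightarrow>
    (\<forall>x. x \<notin> {0..1} \<longrightarrow> s x = 0) \<and> (\<exists>g \<in> spline_space p \<tau>. has_deriv01 s g)"
proof
  obtain k where k: "p = Suc k" using assms(1) by (cases p) auto
  {
    assume s: "s \<in> spline_space (Suc p) \<tau>"
    then have "s \<in> C01 (Suc k)" by (simp add: spline_space_iff k)
    then have "has_deriv01 s (deriv01 1 s)"
      unfolding C01_Suc_iff by (blast intro: has_deriv01_deriv01)
    \<comment> \<open>Members of a spline space vanish outside [0,1], which is not known of the raw
      derivative; hence the restriction.\<close>
    then have D: "has_deriv01 s (restrict01 (deriv01 1 s))"
      by (rule has_deriv01_cong[rotated 2]) (simp_all add: restrict01_eq)
    have "restrict01 (deriv01 1 s) \<in> spline_space p \<tau>"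
      using s C01_Suc_has_deriv01[OF D, of k] piecewise_poly_Suc_iff[OF assms(2) D, of p]
      by (simp add: spline_space_iff k restrict01_eq_0 del: One_nat_def)
    with D s show "(\<forall>x. x \<notin> {0..1} \<longrightarrow> s x = 0) \<and> (\<exists>g \<in> spline_space p \<tau>. has_deriv01 s g)"
      by (auto simp: spline_space_iff)
  }
  {
    assume s: "(\<forall>x. x \<notin> {0..1} \<longrightarrow> s x = 0) \<and> (\<exists>g \<in> spline_space p \<tau>. has_deriv01 s g)"
    then obtain g where g: "g \<in> spline_space p \<tau>" "has_deriv01 s g" by blast
    then show "s \<in> spline_space (Suc p) \<tau>"
      using s C01_Suc_has_deriv01[OF g(2), of k] piecewise_poly_Suc_iff[OF assms(2) g(2), of p]
      by (simp add: spline_space_iff k)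
  }
qed

text \<open>The break points depend on p only through its parity, which makes an induction in steps
  of 2 possible on a fixed partition.\<close>

lemma opt_breaks_Suc_Suc: "opt_breaks (Suc (Suc p)) n = opt_breaks p n"
  by (simp add: opt_breaks_def)

lemma length_opt_breaks: "length (opt_breaks p n) = (if odd p then n + 2 else n + 3)"
  by (simp add: opt_breaks_def)

lemma nth_opt_breaks_odd:
  "odd p \<Longrightarrow> j \<le> n + 1 \<Longrightarrow> opt_breaks p n ! j = real j / real (n + 1)"
  by (simp add: opt_breaks_def del: upt_Suc)

lemma nth_opt_breaks_even:
  assumes "even p"
  shows "opt_breaks p n ! 0 = 0"
    and "j \<le> n \<Longrightarrow> opt_breaks p n ! (Suc j) = (real j + 1 / 2) / real (n + 1)"
    and "opt_breaks p n ! (n + 2) = 1"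
  using assms by (simp_all add: opt_breaks_def nth_append del: upt_Suc)

lemma breaks01_opt_breaks: "breaks01 (opt_breaks p n)"
  unfolding breaks01_def
proof (intro allI impI)
  fix j assume j: "j < length (opt_breaks p n) - 1"
  let ?\<tau> = "opt_breaks p n"
  show "0 \<le> ?\<tau> ! j \<and> ?\<tau> ! j < ?\<tau> ! (j + 1) \<and> ?\<tau> ! (j + 1) \<le> 1"
  proof (cases "odd p")
    case True
    then show ?thesis using j
      by (simp add: length_opt_breaks nth_opt_breaks_odd field_simps)
  next
    case False
    then have e: "even p" by simp
    have "j < n + 2" using j e by (simp add: length_opt_breaks)
    then consider "j = 0" | i where "j = Suc i" "i < n" | "j = Suc n"
      by (cases j) (auto simp: less_Suc_eq)
    then show ?thesis
    proof cases
      case 1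
      then show ?thesis
        by (simp add: nth_opt_breaks_even(1)[OF e] nth_opt_breaks_even(2)[OF e, of 0 n, simplified] divide_simps)
    next
      case 2
      then show ?thesis
        by (simp add: nth_opt_breaks_even(2)[OF e] divide_simps)
    next
      case 3
      then show ?thesis
        by (simp add: nth_opt_breaks_even(2)[OF e] nth_opt_breaks_even(3)[OF e, simplified] divide_simps)
    qed
  qed
qed

text \<open>An end condition of even order at least 2 on s is one of order two less on its second
  derivative; only the condition of order 0 stays with s.\<close>

lemma opt_space_Suc_Suc_iff:
  assumes "p \<ge> 1"
  shows "s \<in> opt_space (Suc (Suc p)) n \<longleftrightarrow>
    (\<forall>x. x \<notin> {0..1} \<longrightarrow> s x = 0) \<and> s 0 = 0 \<and> s 1 = 0 \<and>
    (\<exists>g h. has_deriv01 s g \<and> has_deriv01 g h \<and> h \<in> opt_space p n)" (is "?L \<longleftrightarrow> ?R")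
proof -
  let ?\<tau> = "opt_breaks p n"
  note b = breaks01_opt_breaks[of p n]
  have deriv: "deriv01 (Suc (Suc k)) s x = deriv01 k h x"
    if "has_deriv01 s g" "has_deriv01 g h" "x \<in> {0..1}" for g h k x
  proof -
    have "deriv01 1 (deriv01 1 s) y = h y" if "y \<in> {0..1}" for y
    proof -
      have "deriv01 1 (deriv01 1 s) y = deriv01 1 g y"
        using deriv01_cong[OF deriv01_1_eq[OF \<open>has_deriv01 s g\<close>] that] .
      then show ?thesis using deriv01_1_eq[OF \<open>has_deriv01 g h\<close> that] by simp
    qed
    from deriv01_cong[OF this \<open>x \<in> {0..1}\<close>] show ?thesis by (simp only: deriv01_Suc[of "Suc k"] deriv01_Suc[of k])
  qed
  have cond: "(\<forall>\<alpha>\<le>Suc (Suc p). even \<alpha> \<longrightarrow> deriv01 \<alpha> s 0 = 0 \<and> deriv01 \<alpha> s 1 = 0) \<longleftrightarrow>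
     s 0 = 0 \<and> s 1 = 0 \<and> (\<forall>\<alpha>\<le>p. even \<alpha> \<longrightarrow> deriv01 \<alpha> h 0 = 0 \<and> deriv01 \<alpha> h 1 = 0)" (is "?A \<longleftrightarrow> ?B")
    if "has_deriv01 s g" "has_deriv01 g h" for g h
  proof
    assume A: ?A
    have "deriv01 \<alpha> h 0 = 0 \<and> deriv01 \<alpha> h 1 = 0" if "\<alpha> \<le> p" "even \<alpha>" for \<alpha>
      using A[rule_format, of "Suc (Suc \<alpha>)"] deriv[OF \<open>has_deriv01 s g\<close> \<open>has_deriv01 g h\<close>] that by simp
    with A[rule_format, of 0] show ?B by simp
  next
    assume B: ?B
    have "deriv01 \<alpha> s 0 = 0 \<and> deriv01 \<alpha> s 1 = 0" if "\<alpha> \<le> Suc (Suc p)" "even \<alpha>" for \<alpha>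
    proof (cases "\<alpha> = 0")
      case False
      with \<open>even \<alpha>\<close> obtain k where "\<alpha> = Suc (Suc k)"
        by (metis not0_implies_Suc odd_one One_nat_def)
      then show ?thesis using B that deriv[OF \<open>has_deriv01 s g\<close> \<open>has_deriv01 g h\<close>, of _ k] by simp
    qed (use B in simp)
    then show ?A by blast
  qed
  show ?thesis
  proof
    assume L: ?L
    then have s: "s \<in> spline_space (Suc (Suc p)) ?\<tau>" by (simp add: opt_space_def opt_breaks_Suc_Suc)
    then obtain g where g: "g \<in> spline_space (Suc p) ?\<tau>" "has_deriv01 s g"
      using spline_space_Suc_iff[OF _ b, of "Suc p" s] by auto
    then obtain h where h: "h \<in> spline_space p ?\<tau>" "has_deriv01 g h"
      using spline_space_Suc_iff[OF assms b, of g] by auto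
    show ?R using L cond[OF g(2) h(2)] g h s by (auto simp: opt_space_def spline_space_iff)
  next
    assume R: ?R
    then obtain g h where gh: "has_deriv01 s g" "has_deriv01 g h" "h \<in> opt_space p n" by blast
    let ?g = "restrict01 g"
    have g': "has_deriv01 s ?g" "has_deriv01 ?g h"
      by (rule has_deriv01_cong[rotated 2, OF gh(1)], simp_all add: restrict01_eq)
        (rule has_deriv01_cong[rotated 2, OF gh(2)], simp_all add: restrict01_eq)
    have "?g \<in> spline_space (Suc p) ?\<tau>"
      using spline_space_Suc_iff[OF assms b, of ?g] g' gh(3) by (auto simp: restrict01_eq_0 opt_space_def)
    then have "s \<in> spline_space (Suc (Suc p)) ?\<tau>"
      using spline_space_Suc_iff[OF _ b, of "Suc p" s] g' R by auto
    with R gh(3) cond[OF g'] show ?L by (auto simp: opt_space_def opt_breaks_Suc_Suc)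
  qed
qed

section \<open>Optimal spaces and odd periodic sequences\<close>

text \<open>Reflection about 0 or M negates the coefficients and fixes the point, so each value
  equals its own negative.\<close>

lemma spline_sum_boundary:
  assumes "odd_periodic M b" "p \<ge> 1"
  shows "spline_sum p b 0 = 0" "spline_sum p b (real M) = 0"
proof -
  have "- spline_sum p b 0 = spline_sum p b 0"
    using spline_sum_reflect[OF assms(2), of b 0 0] odd_periodic_minus[OF assms(1)]
    by (simp add: spline_sum_uminus)
  then show "spline_sum p b 0 = 0" by simp
  have "- spline_sum p b (real M) = spline_sum p b (real M)"
    using spline_sum_reflect[OF assms(2), of b "2 * int M" "real M"] odd_periodic_reflect[OF assms(1)]
    by (simp add: spline_sum_uminus)
  then show "spline_sum p b (real M) = 0" by simp
qed

text \<open>The two shifted sums of the derivative are merged into one by moving the index, which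
  produces first differences at an argument off by 1/2.\<close>

lemma has_deriv01_spline_sum:
  assumes "p \<ge> 1"
  shows "has_deriv01 (\<lambda>x. spline_sum (Suc p) b (c * x))
    (\<lambda>x. c * spline_sum p (\<lambda>l. b (l + 1) - b l) (c * x - 1/2))"
  unfolding has_deriv01_def
proof
  fix x :: real
  have "((\<lambda>x. spline_sum (Suc p) b (c * x)) has_real_derivative
     (spline_sum p b (c * x + 1/2) - spline_sum p b (c * x - 1/2)) * c) (at x within {0..1})"
    by (rule DERIV_chain2[OF DERIV_spline_sum[OF assms]]) (auto intro!: derivative_eq_intros)
  moreover have "spline_sum p b (c * x + 1/2) = spline_sum p (\<lambda>l. b (l + 1)) (c * x - 1/2)"
    using spline_sum_shift[of p b 1 "c * x - 1/2"] by (simp add: add.commute)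
  ultimately show "((\<lambda>x. spline_sum (Suc p) b (c * x)) has_real_derivative
     c * spline_sum p (\<lambda>l. b (l + 1) - b l) (c * x - 1/2)) (at x within {0..1})"
    by (simp add: spline_sum_diff mult.commute)
qed

lemma has_deriv01_spline_sum2:
  assumes "p \<ge> 1"
  obtains g where "has_deriv01 (\<lambda>x. spline_sum (Suc (Suc p)) b (c * x)) g"
    "has_deriv01 g (\<lambda>x. c\<^sup>2 * spline_sum p (second_diff b) (c * x))"
proof
  let ?d = "\<lambda>l. b (l + 1) - b l"
  let ?g = "\<lambda>x. c * spline_sum (Suc p) ?d (c * x - 1/2)"
  show "has_deriv01 (\<lambda>x. spline_sum (Suc (Suc p)) b (c * x)) ?g"
    by (rule has_deriv01_spline_sum) simp
  show "has_deriv01 ?g (\<lambda>x. c\<^sup>2 * spline_sum p (second_diff b) (c * x))"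
    unfolding has_deriv01_def
  proof
    fix x :: real
    have D: "(?g has_real_derivative
       c * ((spline_sum p ?d (c * x - 1/2 + 1/2) - spline_sum p ?d (c * x - 1/2 - 1/2)) * c)) (at x within {0..1})"
      by (intro DERIV_cmult DERIV_chain2[OF DERIV_spline_sum[OF assms]]) (auto intro!: derivative_eq_intros)
    \<comment> \<open>The two half shifts add up to an integer, which the coefficients absorb; first
      differences become the centered second difference.\<close>
    have "spline_sum p ?d (c * x - 1) = spline_sum p (\<lambda>l. b l - b (l - 1)) (c * x)"
      using spline_sum_shift[of p ?d "- 1" "c * x"] by simp
    moreover have "second_diff b = (\<lambda>l. ?d l - (b l - b (l - 1)))"
      by (simp add: second_diff_def fun_eq_iff)
    ultimately have "spline_sum p (second_diff b) (c * x) = spline_sum p ?d (c * x) - spline_sum p ?d (c * x - 1)"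
      by (simp only: spline_sum_diff[of p ?d])
    then have "c * ((spline_sum p ?d (c * x - 1/2 + 1/2) - spline_sum p ?d (c * x - 1/2 - 1/2)) * c) =
      c\<^sup>2 * spline_sum p (second_diff b) (c * x)"
      by (simp add: power2_eq_square)
    with D show "(?g has_real_derivative c\<^sup>2 * spline_sum p (second_diff b) (c * x)) (at x within {0..1})"
      by (simp only:)
  qed
qed

section \<open>The linear base case\<close>

lemma find_piece:
  assumes "M \<ge> 1" "0 \<le> y" "y \<le> real M"
  obtains j where "j < M" "real j \<le> y" "y \<le> real j + 1"
proof (cases "y < real M")
  case True
  show ?thesis
  proof
    show "nat \<lfloor>y\<rfloor> < M" "real (nat \<lfloor>y\<rfloor>) \<le> y" "y \<le> real (nat \<lfloor>y\<rfloor>) + 1"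
      using True assms by linarith+
  qed
next
  case False
  \<comment> \<open>The right end y = M belongs to the last closed piece, where the floor would give
    one index too many.\<close>
  then show ?thesis using assms by (intro that[of "M - 1"]) auto
qed

lemma degree_le_1_poly:
  assumes "degree q \<le> 1"
  obtains a c where "\<And>x::real. poly q x = a + c * x"
proof (cases q)
  case (pCons a r)
  have "degree r = 0"
    using assms pCons by (cases "r = 0") (simp_all add: degree_pCons_eq)
  then obtain c where "r = [:c:]" by (rule degree_eq_zeroE)
  with pCons show ?thesis by (intro that[of a c]) (simp add: mult.commute)
qed

lemma opt_space_1:
  assumes M: "M \<ge> 1"
  shows "s \<in> opt_space 1 (M - 1) \<longleftrightarrow>
    (\<exists>b. odd_periodic M b \<and> s = restrict01 (\<lambda>x. spline_sum 1 b (real M * x)))"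
proof -
  let ?\<tau> = "opt_breaks 1 (M - 1)"
  have nth: "?\<tau> ! j = real j / real M" if "j \<le> M" for j
    using nth_opt_breaks_odd[of 1 j "M - 1"] M that by simp
  have len: "length ?\<tau> - 1 = M" using M by (simp add: length_opt_breaks)
  have mem: "s \<in> opt_space 1 (M - 1) \<longleftrightarrow> continuous_on {0..1} s \<and> (\<forall>x. x \<notin> {0..1} \<longrightarrow> s x = 0)
    \<and> piecewise_poly 1 ?\<tau> s \<and> s 0 = 0 \<and> s 1 = 0"
  proof -
    have "(\<forall>\<alpha>\<le>1. even \<alpha> \<longrightarrow> deriv01 \<alpha> s 0 = 0 \<and> deriv01 \<alpha> s 1 = 0) \<longleftrightarrow> s 0 = 0 \<and> s 1 = 0"
      by (auto simp: le_Suc_eq)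
    then show ?thesis by (auto simp: opt_space_def spline_space_iff C01_def)
  qed
  show ?thesis
  proof
    assume "\<exists>b. odd_periodic M b \<and> s = restrict01 (\<lambda>x. spline_sum 1 b (real M * x))"
    then obtain b where b: "odd_periodic M b" and s: "s = restrict01 (\<lambda>x. spline_sum 1 b (real M * x))" by blast
    have "continuous_on {0..1} (\<lambda>x. spline_sum 1 b (real M * x))"
      by (rule continuous_on_compose2[OF continuous_on_spline_sum_1[of UNIV]]) (intro continuous_intros, simp)
    then have "continuous_on {0..1} s"
      unfolding s using continuous_on_cong[OF refl, of "{0..1}" "restrict01 (\<lambda>x. spline_sum 1 b (real M * x))"]
      by (simp add: restrict01_eq)
    moreover have "piecewise_poly 1 ?\<tau> s"
    proof (rule piecewise_poly_cong[OF breaks01_opt_breaks])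
      show "piecewise_poly 1 ?\<tau> (\<lambda>x. spline_sum 1 b (real M * x))"
        unfolding piecewise_poly_def len
      proof (intro allI impI)
        fix j assume j: "j < M"
        let ?q = "[:b j * (real j + 1) - b (int j + 1) * real j, real M * (b (int j + 1) - b j):]"
        have "\<forall>x\<in>{?\<tau> ! j..?\<tau> ! (j + 1)}. spline_sum 1 b (real M * x) = poly ?q x"
        proof
          fix x assume "x \<in> {?\<tau> ! j..?\<tau> ! (j + 1)}"
          then have "real j / real M \<le> x" "x \<le> (real j + 1) / real M"
            using j nth[of j] nth[of "j + 1"] by (simp_all add: add.commute)
          then have "real j \<le> real M * x" "real M * x \<le> real j + 1"
            using M by (simp_all add: field_simps)
          then show "spline_sum 1 b (real M * x) = poly ?q x"
            using spline_sum_1[of "int j" "real M * x" b] by (simp add: algebra_simps)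
        qed
        then show "\<exists>q. degree q \<le> 1 \<and> (\<forall>x\<in>{?\<tau> ! j..?\<tau> ! (j + 1)}. spline_sum 1 b (real M * x) = poly q x)"
          by (intro exI[of _ ?q]) auto
      qed
    qed (simp add: s restrict01_eq)
    ultimately show "s \<in> opt_space 1 (M - 1)"
      unfolding mem using spline_sum_boundary[OF b, of 1] by (simp add: s restrict01_eq restrict01_eq_0)
  next
    assume S: "s \<in> opt_space 1 (M - 1)"
    \<comment> \<open>The extension exists because s vanishes at 0 and 1. On each element, both s
      and the spline sum are then the linear interpolant of the same two values.\<close>
    obtain b where b: "odd_periodic M b" "\<And>r. r \<le> M \<Longrightarrow> b (int r) = s (real r / real M)"
      by (rule odd_periodic_extension[of M "\<lambda>r. s (real r / real M)"]) (use M S mem in auto)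
    have "s x = spline_sum 1 b (real M * x)" if x: "x \<in> {0..1}" for x
    proof -
      have "0 \<le> real M * x" "real M * x \<le> real M" using x mult_left_mono[of x 1 "real M"] by auto
      then obtain j where j: "j < M" "real j \<le> real M * x" "real M * x \<le> real j + 1"
        using find_piece[OF M] by blast
      obtain q where q: "degree q \<le> 1" "\<forall>x\<in>{?\<tau> ! j..?\<tau> ! (j + 1)}. s x = poly q x"
        using S j(1) unfolding mem piecewise_poly_def len by blast
      obtain a c where ac: "\<And>x. poly q x = a + c * x" using degree_le_1_poly[OF q(1)] by blast
      have lin: "s x = a + c * x" if "real j / real M \<le> x" "x \<le> (real j + 1) / real M" for x
        using q(2) ac that nth[of j] nth[of "j + 1"] j(1) by (auto simp: add.commute)
      have "s x = a + c * x" using j M by (intro lin) (simp_all add: field_simps)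
      moreover have "s (real j / real M) = a + c * (real j / real M)"
        using M by (intro lin) (simp_all add: field_simps)
      moreover have "s ((real j + 1) / real M) = a + c * ((real j + 1) / real M)"
        using M by (intro lin) (simp_all add: field_simps)
      moreover have "b (int j) = s (real j / real M)" "b (int j + 1) = s ((real j + 1) / real M)"
        using b(2)[of j] b(2)[of "Suc j"] j(1) by (simp_all add: add.commute)
      moreover have "spline_sum 1 b (real M * x) = b (int j) * (real j + 1 - real M * x) + b (int j + 1) * (real M * x - real j)"
        using spline_sum_1[of "int j" "real M * x" b] j by simp
      moreover have "(a + c * (real j / real M)) * (real j + 1 - real M * x) +
          (a + c * ((real j + 1) / real M)) * (real M * x - real j) = a + c * x"
        using M by (simp add: field_simps)
      ultimately show ?thesis by simp
    qed
    then have "s = restrict01 (\<lambda>x. spline_sum 1 b (real M * x))"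
      using S unfolding mem by (auto simp: restrict01_def fun_eq_iff)
    with b(1) show "\<exists>b. odd_periodic M b \<and> s = restrict01 (\<lambda>x. spline_sum 1 b (real M * x))" by blast
  qed
qed

section \<open>The step from degree p to degree p + 2\<close>

lemma opt_space_step:
  assumes p: "p \<ge> 1" and M: "M \<ge> 1"
    and IH: "\<And>s. s \<in> opt_space p n \<longleftrightarrow>
      (\<exists>b. odd_periodic M b \<and> s = restrict01 (\<lambda>x. spline_sum p b (real M * x)))"
  shows "s \<in> opt_space (Suc (Suc p)) n \<longleftrightarrow>
      (\<exists>b. odd_periodic M b \<and> s = restrict01 (\<lambda>x. spline_sum (Suc (Suc p)) b (real M * x)))"
  unfolding opt_space_Suc_Suc_iff[OF p]
proof
  assume "\<exists>b. odd_periodic M b \<and> s = restrict01 (\<lambda>x. spline_sum (Suc (Suc p)) b (real M * x))"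
  then obtain b where b: "odd_periodic M b"
    and s: "s = restrict01 (\<lambda>x. spline_sum (Suc (Suc p)) b (real M * x))" by blast
  obtain g where g: "has_deriv01 (\<lambda>x. spline_sum (Suc (Suc p)) b (real M * x)) g"
    "has_deriv01 g (\<lambda>x. (real M)\<^sup>2 * spline_sum p (second_diff b) (real M * x))"
    by (rule has_deriv01_spline_sum2[OF p])
  let ?h = "restrict01 (\<lambda>x. spline_sum p (\<lambda>l. (real M)\<^sup>2 * second_diff b l) (real M * x))"
  have "?h \<in> opt_space p n"
    unfolding IH using odd_periodic_cmult[OF odd_periodic_second_diff[OF b]] by blast
  moreover have "has_deriv01 s g"
    by (rule has_deriv01_cong[OF _ refl g(1)]) (simp add: s restrict01_eq)
  moreover have "has_deriv01 g ?h"
    by (rule has_deriv01_cong[OF refl _ g(2)]) (simp add: restrict01_eq spline_sum_cmult)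
  ultimately show "(\<forall>x. x \<notin> {0..1} \<longrightarrow> s x = 0) \<and> s 0 = 0 \<and> s 1 = 0 \<and>
      (\<exists>g h. has_deriv01 s g \<and> has_deriv01 g h \<and> h \<in> opt_space p n)"
    using spline_sum_boundary[OF b, of "Suc (Suc p)"] by (auto simp: s restrict01_eq restrict01_eq_0)
next
  assume S: "(\<forall>x. x \<notin> {0..1} \<longrightarrow> s x = 0) \<and> s 0 = 0 \<and> s 1 = 0 \<and>
      (\<exists>g h. has_deriv01 s g \<and> has_deriv01 g h \<and> h \<in> opt_space p n)"
  then obtain g h where gh: "has_deriv01 s g" "has_deriv01 g h" "h \<in> opt_space p n" by blast
  then obtain a where a: "odd_periodic M a" "h = restrict01 (\<lambda>x. spline_sum p a (real M * x))"
    unfolding IH by blast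
  \<comment> \<open>The factor cancels the square of M that the chain rule produces in two
    derivatives.\<close>
  obtain b where b: "odd_periodic M b" "second_diff b = (\<lambda>l. (1 / (real M)\<^sup>2) * a l)"
    by (rule second_diff_surj[OF odd_periodic_cmult[OF a(1)] M])
  let ?t = "\<lambda>x. spline_sum (Suc (Suc p)) b (real M * x)"
  obtain k where k: "has_deriv01 ?t k"
    "has_deriv01 k (\<lambda>x. (real M)\<^sup>2 * spline_sum p (second_diff b) (real M * x))"
    by (rule has_deriv01_spline_sum2[OF p])
  \<comment> \<open>Equal second derivatives leave an affine difference of s and \<open>?t\<close>,
    and both vanish at 0 and 1.\<close>
  have "has_deriv01 (\<lambda>x. g x - k x) (\<lambda>x. 0)"
    by (rule has_deriv01_cong[OF refl _ has_deriv01_diff[OF gh(2) k(2)]])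
      (use M in \<open>simp add: a(2) restrict01_eq b(2) spline_sum_cmult del: times_divide_eq_left\<close>)
  then have "\<exists>D. \<forall>x\<in>{0..1}. g x - k x = D"
    unfolding has_deriv01_def by (intro has_field_derivative_zero_constant) auto
  then obtain D where D: "\<And>x. x \<in> {0..1} \<Longrightarrow> g x - k x = D" by blast
  have "has_deriv01 (\<lambda>x. s x - ?t x) (\<lambda>x. D)"
    by (rule has_deriv01_cong[OF refl D has_deriv01_diff[OF gh(1) k(1)]])
  then have "s x - ?t x = 0" if "x \<in> {0..1}" for x
    by (rule has_deriv01_const_imp_0[OF _ _ _ that])
      (use S spline_sum_boundary[OF b(1), of "Suc (Suc p)"] in auto)
  then have "s = restrict01 ?t" using S by (auto simp: restrict01_def fun_eq_iff)
  with b(1) show "\<exists>b. odd_periodic M b \<and> s = restrict01 (\<lambda>x. spline_sum (Suc (Suc p)) b (real M * x))"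
    by blast
qed

section \<open>Injectivity of the coefficient map\<close>

lemma spline_sum_inj_1:
  assumes b: "odd_periodic M b" and M: "M \<ge> 1"
    and z: "\<And>x. x \<in> {0..1} \<Longrightarrow> spline_sum 1 b (real M * x) = 0"
  shows "b l = 0"
proof (rule odd_periodic_zeroI[OF b M])
  fix r assume r: "r \<in> {1..M - 1}"
  have "spline_sum 1 b (real M * (real r / real M)) = 0" using r by (intro z) (auto simp: field_simps)
  then show "b (int r) = 0" using spline_sum_1[of "int r" "real r" b] r M by simp
qed

text \<open>The derivative of the zero function shows that consecutive coefficients agree, and the
  chain starts at \<open>b 0 = 0\<close>.\<close>

lemma spline_sum_inj_2:
  assumes b: "odd_periodic M b" and M: "M \<ge> 1"
    and z: "\<And>x. x \<in> {0..1} \<Longrightarrow> spline_sum 2 b (real M * x) = 0"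
  shows "b l = 0"
proof -
  let ?d = "\<lambda>l. b (l + 1) - b l"
  have "has_deriv01 (\<lambda>x. 0) (\<lambda>x. real M * spline_sum 1 ?d (real M * x - 1/2))"
    by (rule has_deriv01_cong[OF _ refl has_deriv01_spline_sum[of 1 b "real M"]])
      (use z in \<open>simp_all add: numeral_2_eq_2\<close>)
  moreover have "has_deriv01 (\<lambda>x. 0) (\<lambda>x. 0)" by (simp add: has_deriv01_def)
  ultimately have z1: "real M * spline_sum 1 ?d (real M * x - 1/2) = 0" if "x \<in> {0..1}" for x
    using has_deriv01_unique that by blast
  have d: "b (int (Suc j)) = b (int j)" if "j < M" for j
  proof -
    have "spline_sum 1 ?d (real j) = 0"
      \<comment> \<open>At this point the shifted argument is the integer j, where the linear
        interpolant returns the coefficient itself.\<close>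
      using z1[of "(real j + 1/2) / real M"] that by (simp add: field_simps)
    then show ?thesis using spline_sum_1[of "int j" "real j" ?d] by (simp add: add.commute)
  qed
  have "b (int j) = 0" if "j \<le> M" for j
    using that by (induction j) (use odd_periodic_0[OF b] d in auto)
  then show ?thesis by (rule odd_periodic_zeroI[OF b M]) auto
qed

text \<open>Differentiating the zero function twice reduces to degree p with coefficients
  \<open>second_diff b\<close>, and the second difference is injective.\<close>

lemma spline_sum_inj_step:
  assumes p: "p \<ge> 1" and M: "M \<ge> 1"
    and IH: "\<And>b l. odd_periodic M b \<Longrightarrow> (\<And>x. x \<in> {0..1} \<Longrightarrow> spline_sum p b (real M * x) = 0) \<Longrightarrow> b l = 0"
    and b: "odd_periodic M b"
    and z: "\<And>x. x \<in> {0..1} \<Longrightarrow> spline_sum (Suc (Suc p)) b (real M * x) = 0"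
  shows "b l = 0"
proof -
  obtain g where g: "has_deriv01 (\<lambda>x. spline_sum (Suc (Suc p)) b (real M * x)) g"
    "has_deriv01 g (\<lambda>x. (real M)\<^sup>2 * spline_sum p (second_diff b) (real M * x))"
    by (rule has_deriv01_spline_sum2[OF p])
  have zero: "has_deriv01 (\<lambda>x. 0) (\<lambda>x. 0)" by (simp add: has_deriv01_def)
  have "has_deriv01 (\<lambda>x. 0) g" by (rule has_deriv01_cong[OF z refl g(1)])
  then have "g x = 0" if "x \<in> {0..1}" for x using has_deriv01_unique[OF _ zero that] by blast
  from has_deriv01_cong[OF this refl g(2)]
  have "has_deriv01 (\<lambda>x. 0) (\<lambda>x. (real M)\<^sup>2 * spline_sum p (second_diff b) (real M * x))" .
  then have "(real M)\<^sup>2 * spline_sum p (second_diff b) (real M * x) = 0" if "x \<in> {0..1}" for x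
    using has_deriv01_unique[OF _ zero that] by blast
  then have "second_diff b l = 0" for l
    using M by (intro IH[OF odd_periodic_second_diff[OF b]]) auto
  then show ?thesis by (rule second_diff_inj[OF b M])
qed

section \<open>The quadratic base case\<close>

lemma deriv01_1_affine:
  assumes "x\<^sub>0 \<in> {0..1}" "e > 0"
    "\<And>x. x \<in> {0..1} \<Longrightarrow> \<bar>x - x\<^sub>0\<bar> < e \<Longrightarrow> g x = a + c * x"
  shows "deriv01 1 g x\<^sub>0 = c"
proof (rule deriv01_1_eqI[OF _ assms(1)])
  have "((\<lambda>x. a + c * x) has_real_derivative c) (at x\<^sub>0 within {0..1})"
    by (auto intro!: derivative_eq_intros)
  then show "(g has_real_derivative c) (at x\<^sub>0 within {0..1})"
    by (rule has_field_derivative_transform_within[OF _ assms(2) assms(1)])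
      (use assms(3) in \<open>auto simp: dist_real_def\<close>)
qed

text \<open>The derivative g is piecewise linear on the break points of even degree, not on those of
  \<open>opt_space 1 n\<close>, so the linear case cannot be reused. The condition of order 2
  becomes a vanishing slope of g at both ends.\<close>

lemma opt_space_2_iff:
  "s \<in> opt_space 2 n \<longleftrightarrow> (\<forall>x. x \<notin> {0..1} \<longrightarrow> s x = 0) \<and> s 0 = 0 \<and> s 1 = 0 \<and>
     (\<exists>g \<in> spline_space 1 (opt_breaks 2 n). has_deriv01 s g \<and> deriv01 1 g 0 = 0 \<and> deriv01 1 g 1 = 0)"
proof -
  have cond: "(\<forall>\<alpha>\<le>2. even \<alpha> \<longrightarrow> deriv01 \<alpha> s 0 = 0 \<and> deriv01 \<alpha> s 1 = 0) \<longleftrightarrow>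
     s 0 = 0 \<and> s 1 = 0 \<and> deriv01 1 g 0 = 0 \<and> deriv01 1 g 1 = 0" if g: "has_deriv01 s g" for g
  proof -
    have d: "deriv01 2 s x = deriv01 1 g x" if "x \<in> {0..1}" for x
    proof -
      have "deriv01 2 s x = deriv01 1 (deriv01 1 s) x" by (simp add: deriv01_def numeral_2_eq_2)
      also have "\<dots> = deriv01 1 g x" by (rule deriv01_cong[OF _ that]) (rule deriv01_1_eq[OF g])
      finally show ?thesis .
    qed
    have "(\<forall>\<alpha>\<le>2. even \<alpha> \<longrightarrow> Q \<alpha>) \<longleftrightarrow> Q 0 \<and> Q 2" for Q :: "nat \<Rightarrow> bool"
      by (auto simp: numeral_2_eq_2 le_Suc_eq)
    then show ?thesis using d[of 0] d[of 1] by (auto simp del: One_nat_def)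
  qed
  have "s \<in> spline_space 2 (opt_breaks 2 n) \<longleftrightarrow>
    (\<forall>x. x \<notin> {0..1} \<longrightarrow> s x = 0) \<and> (\<exists>g \<in> spline_space 1 (opt_breaks 2 n). has_deriv01 s g)"
    using spline_space_Suc_iff[OF order_refl breaks01_opt_breaks, of s 2 n] by (simp add: numeral_2_eq_2)
  then show ?thesis unfolding opt_space_def using cond by blast
qed

text \<open>The first and last elements have half the usual length. Enclosing every element in a
  full cell centered at j/M lets one formula cover them all.\<close>

lemma opt_breaks_2_bounds:
  assumes "M \<ge> 1" "j \<le> M"
  shows "(real j - 1/2) / real M \<le> opt_breaks 2 (M - 1) ! j"
    and "opt_breaks 2 (M - 1) ! (j + 1) \<le> (real j + 1/2) / real M"
proof -
  let ?\<tau> = "opt_breaks 2 (M - 1)"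
  have \<tau>: "?\<tau> ! 0 = 0" "?\<tau> ! Suc i = (real i + 1/2) / real M" if "i < M" for i
    using nth_opt_breaks_even(1)[of 2 "M - 1"] nth_opt_breaks_even(2)[of 2 i "M - 1"] that assms(1) by auto
  have \<tau>1: "?\<tau> ! Suc M = 1" using nth_opt_breaks_even(3)[of 2 "M - 1"] assms(1) by simp
  show "(real j - 1/2) / real M \<le> ?\<tau> ! j"
    using \<tau>(1)[of 0] \<tau>(2)[of "j - 1"] assms by (cases j) (auto simp: field_simps)
  show "?\<tau> ! (j + 1) \<le> (real j + 1/2) / real M"
    using \<tau>1 \<tau>(2)[of j] assms by (cases "j = M") auto
qed

lemma opt_space_2:
  assumes M: "M \<ge> 1"
  shows "s \<in> opt_space 2 (M - 1) \<longleftrightarrow>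
    (\<exists>b. odd_periodic M b \<and> s = restrict01 (\<lambda>x. spline_sum 2 b (real M * x)))"
proof -
  let ?\<tau> = "opt_breaks 2 (M - 1)"
  have nth: "?\<tau> ! 0 = 0" "?\<tau> ! Suc j = (real j + 1/2) / real M" if "j < M" for j
    using nth_opt_breaks_even(1)[of 2 "M - 1"] nth_opt_breaks_even(2)[of 2 j "M - 1"] that M by auto
  have nth1: "?\<tau> ! Suc M = 1" using nth_opt_breaks_even(3)[of 2 "M - 1"] M by simp
  have len: "length ?\<tau> - 1 = Suc M" using M by (simp add: length_opt_breaks)
  show ?thesis
  proof
    assume "\<exists>b. odd_periodic M b \<and> s = restrict01 (\<lambda>x. spline_sum 2 b (real M * x))"
    then obtain b where b: "odd_periodic M b" and s: "s = restrict01 (\<lambda>x. spline_sum 2 b (real M * x))" by blast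
    let ?d = "\<lambda>l. b (l + 1) - b l"
    let ?g = "\<lambda>x. real M * spline_sum 1 ?d (real M * x - 1/2)"
    have D: "has_deriv01 s (restrict01 ?g)"
      by (rule has_deriv01_cong[OF _ _ has_deriv01_spline_sum[of 1 b "real M"]])
        (simp_all add: s restrict01_eq numeral_2_eq_2)
    have "continuous_on {0..1} (\<lambda>x. spline_sum 1 ?d (real M * x - 1/2))"
      by (rule continuous_on_compose2[OF continuous_on_spline_sum_1[of UNIV]]) (intro continuous_intros, simp)
    then have "continuous_on {0..1} ?g" by (intro continuous_intros)
    then have cont: "continuous_on {0..1} (restrict01 ?g)"
      using continuous_on_cong[OF refl, of "{0..1}" "restrict01 ?g" ?g] by (simp add: restrict01_eq)
    have "piecewise_poly 1 ?\<tau> (restrict01 ?g)"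
    proof (rule piecewise_poly_cong[OF breaks01_opt_breaks])
      show "piecewise_poly 1 ?\<tau> ?g"
        unfolding piecewise_poly_def len
      proof (intro allI impI)
        fix j assume "j < Suc M"
        then have j: "j \<le> M" by simp
        \<comment> \<open>On element j the shifted argument lies between j - 1 and j.\<close>
        let ?i = "int j - 1"
        let ?q = "[:real M * (?d ?i * (real j + 1/2) - ?d (?i + 1) * (real j - 1/2)),
          real M * (real M * (?d (?i + 1) - ?d ?i)):]"
        have "\<forall>x\<in>{?\<tau> ! j..?\<tau> ! (j + 1)}. ?g x = poly ?q x"
        proof
          fix x assume "x \<in> {?\<tau> ! j..?\<tau> ! (j + 1)}"
          then have "(real j - 1/2) / real M \<le> x" "x \<le> (real j + 1/2) / real M"
            using opt_breaks_2_bounds[OF M j] by auto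
          then have "real_of_int ?i \<le> real M * x - 1/2" "real M * x - 1/2 \<le> real_of_int ?i + 1"
            using M by (simp_all add: field_simps)
          then show "?g x = poly ?q x"
            by (subst spline_sum_1[of ?i]) (simp_all add: algebra_simps)
        qed
        then show "\<exists>q. degree q \<le> 1 \<and> (\<forall>x\<in>{?\<tau> ! j..?\<tau> ! (j + 1)}. ?g x = poly q x)"
          by (intro exI[of _ ?q]) simp
      qed
    qed (simp add: restrict01_eq)
    with cont have G: "restrict01 ?g \<in> spline_space 1 ?\<tau>"
      by (simp add: spline_space_iff C01_def restrict01_eq_0)
    have e: "1 / (2 * real M) > 0" using M by simp
    have "deriv01 1 (restrict01 ?g) 0 = 0"
    proof (rule deriv01_1_affine[OF _ e])
      fix x :: real assume x: "x \<in> {0..1}" "\<bar>x - 0\<bar> < 1 / (2 * real M)"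
      then have "0 \<le> real M * x" "real M * x \<le> 1/2" using M by (auto simp: field_simps)
      then have "real_of_int (- 1) \<le> real M * x - 1/2" "real M * x - 1/2 \<le> real_of_int (- 1) + 1"
        by simp_all
      \<comment> \<open>By oddness the differences at -1 and 0 are both \<open>b 1\<close>, so the
        interpolated derivative is constant on the first half element. At the right end the
        reflection about M plays this part.\<close>
      from spline_sum_1[OF this, of ?d]
      have "spline_sum 1 ?d (real M * x - 1/2) = b 1"
        using odd_periodic_0[OF b] odd_periodic_minus[OF b, of 1] by (simp add: algebra_simps)
      then show "restrict01 ?g x = real M * b 1 + 0 * x" using x by (simp add: restrict01_eq)
    qed simp
    moreover have "deriv01 1 (restrict01 ?g) 1 = 0"
    proof (rule deriv01_1_affine[OF _ e])
      fix x :: real assume x: "x \<in> {0..1}" "\<bar>x - 1\<bar> < 1 / (2 * real M)"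
      then have "real M * (1 - x) < 1 / 2" "real M * x \<le> real M"
        using M mult_left_mono[of x 1 "real M"] by (auto simp: field_simps)
      then have "real_of_int (int M - 1) \<le> real M * x - 1/2" "real M * x - 1/2 \<le> real_of_int (int M - 1) + 1"
        by (simp_all add: algebra_simps)
      from spline_sum_1[OF this, of ?d]
      have "spline_sum 1 ?d (real M * x - 1/2) = - b (int M - 1)"
        using odd_periodic_M[OF b] odd_periodic_reflect[OF b, of "int M - 1"] by (simp add: algebra_simps)
      then show "restrict01 ?g x = - real M * b (int M - 1) + 0 * x" using x by (simp add: restrict01_eq)
    qed simp
    ultimately show "s \<in> opt_space 2 (M - 1)"
      unfolding opt_space_2_iff using D G spline_sum_boundary[OF b, of 2]
      by (auto simp: s restrict01_eq restrict01_eq_0)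
  next
    assume "s \<in> opt_space 2 (M - 1)"
    then obtain g where s: "\<And>x. x \<notin> {0..1} \<Longrightarrow> s x = 0" "s 0 = 0" "s 1 = 0"
      and g: "g \<in> spline_space 1 ?\<tau>" "has_deriv01 s g" "deriv01 1 g 0 = 0" "deriv01 1 g 1 = 0"
      unfolding opt_space_2_iff by blast
    have affine: "\<exists>a c. \<forall>x. ?\<tau> ! j \<le> x \<longrightarrow> x \<le> ?\<tau> ! Suc j \<longrightarrow> g x = a + c * x" if j: "j \<le> M" for j
    proof -
      obtain q where q: "degree q \<le> 1" "\<forall>x\<in>{?\<tau> ! j..?\<tau> ! (j + 1)}. g x = poly q x"
        using g(1) len le_imp_less_Suc[OF j] unfolding spline_space_iff piecewise_poly_def by auto
      obtain a c where "\<And>x. poly q x = a + c * x" using degree_le_1_poly[OF q(1)] by blast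
      with q(2) show ?thesis by auto
    qed
    have e: "1 / (2 * real M) > 0" using M by simp
    \<comment> \<open>On the half element at 0, g is affine with zero slope at 0, hence
      constant.\<close>
    have first: "g x = g (1 / (2 * real M))" if "0 \<le> x" "x \<le> 1 / (2 * real M)" for x
    proof -
      have t: "?\<tau> ! 0 = 0" "?\<tau> ! Suc 0 = 1 / (2 * real M)" using nth[of 0] M by simp_all
      obtain a c where ac: "\<And>x. 0 \<le> x \<Longrightarrow> x \<le> 1 / (2 * real M) \<Longrightarrow> g x = a + c * x"
        using affine[of 0] unfolding t by auto
      have "deriv01 1 g 0 = c" by (rule deriv01_1_affine[OF _ e, of _ _ a]) (auto intro!: ac)
      then have "c = 0" using g(3) by simp
      then show ?thesis using ac[OF that] ac[of "1 / (2 * real M)"] by simp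
    qed
    have last: "g x = g ((real M - 1/2) / real M)" if "(real M - 1/2) / real M \<le> x" "x \<le> 1" for x
    proof -
      have t: "?\<tau> ! M = (real M - 1/2) / real M" "?\<tau> ! Suc M = 1"
        using nth(2)[of "M - 1"] nth1 M by simp_all
      obtain a c where ac: "\<And>x. (real M - 1/2) / real M \<le> x \<Longrightarrow> x \<le> 1 \<Longrightarrow> g x = a + c * x"
        using affine[of M] unfolding t by auto
      have "deriv01 1 g 1 = c"
        by (rule deriv01_1_affine[OF _ e, of _ _ a], simp, rule ac) (use M in \<open>auto simp: field_simps\<close>)
      then have "c = 0" using g(4) by simp
      then show ?thesis using ac[OF that] ac[of "(real M - 1/2) / real M"] M by simp
    qed
    \<comment> \<open>These are the differences that b should have, scaled by the chain rule.
      Removing the mean D / M from each makes the partial sums return to 0 at M, at the cost of the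
      constant D in \<open>gD\<close>.\<close>
    define d where "d j = g ((real j + 1/2) / real M) / real M" for j
    define D where "D = (\<Sum>j<M. d j)"
    obtain b where b: "odd_periodic M b" "\<And>r. r \<le> M \<Longrightarrow> b (int r) = (\<Sum>j<r. d j) - real r * D / real M"
      by (rule odd_periodic_extension[of M "\<lambda>r. (\<Sum>j<r. d j) - real r * D / real M"])
        (use M in \<open>auto simp: D_def\<close>)
    let ?d = "\<lambda>l. b (l + 1) - b l"
    have diff: "?d (int j) = d j - D / real M" if "j < M" for j
      using b(2)[of j] b(2)[of "Suc j"] that by (simp add: add_divide_distrib algebra_simps)
    have gD: "g x - real M * spline_sum 1 ?d (real M * x - 1/2) = D" if x: "x \<in> {0..1}" for x
    proof -
      consider "x \<le> 1 / (2 * real M)" | "(real M - 1/2) / real M \<le> x"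
        | "1 / (2 * real M) < x" "x \<le> (real M - 1/2) / real M" by linarith
      then show ?thesis
      proof cases
        case 1
        have "0 \<le> real M * x" "real M * x \<le> 1/2" using x 1 M by (auto simp: field_simps)
        then have "real_of_int (- 1) \<le> real M * x - 1/2" "real M * x - 1/2 \<le> real_of_int (- 1) + 1"
          by simp_all
        from spline_sum_1[OF this, of ?d]
        have "spline_sum 1 ?d (real M * x - 1/2) = ?d 0"
          using odd_periodic_0[OF b(1)] odd_periodic_minus[OF b(1), of 1]
          by (simp add: algebra_simps)
        also have "\<dots> = d 0 - D / real M" using diff[of 0] M by simp
        finally show ?thesis using first[of x] x 1 M by (simp add: d_def field_simps)
      next
        case 2
        have "real M * x \<le> real M" using x mult_left_mono[of x 1 "real M"] by simp
        moreover have "real M - 1/2 \<le> real M * x" using 2 M by (simp add: field_simps)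
        ultimately have "real_of_int (int M - 1) \<le> real M * x - 1/2" "real M * x - 1/2 \<le> real_of_int (int M - 1) + 1"
          by simp_all
        from spline_sum_1[OF this, of ?d]
        have "spline_sum 1 ?d (real M * x - 1/2) = ?d (int M - 1)"
          using odd_periodic_M[OF b(1)] odd_periodic_reflect[OF b(1), of "int M - 1"]
          by (simp add: algebra_simps)
        also have "\<dots> = d (M - 1) - D / real M" using diff[of "M - 1"] M by simp
        finally show ?thesis using last[of x] x 2 M by (simp add: d_def field_simps)
      next
        case 3
        show ?thesis
        proof (cases "M = 1")
          case True
          then show ?thesis using 3 by simp
        next
          case False
          let ?y = "real M * x - 1/2"
          have "0 \<le> ?y" "?y \<le> real (M - 1)" using 3 M by (simp_all add: field_simps)
          \<comment> \<open>M interior break points bound M - 1 full elements; for M = 1 there are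
            none and the case is void.\<close>
          then obtain j where j: "j < M - 1" "real j \<le> ?y" "?y \<le> real j + 1"
            using find_piece[of "M - 1" ?y] M False by force
          have "real (Suc j) + 1/2 = real j + 3/2" by simp
          then have t: "?\<tau> ! Suc j = (real j + 1/2) / real M" "?\<tau> ! Suc (Suc j) = (real j + 3/2) / real M"
            using nth(2)[of j] nth(2)[of "Suc j"] j(1) by (simp_all only: less_diff_conv)
          have sj: "Suc j \<le> M" using j(1) by simp
          obtain a c where ac: "\<And>x. (real j + 1/2) / real M \<le> x \<Longrightarrow> x \<le> (real j + 3/2) / real M \<Longrightarrow> g x = a + c * x"
            using affine[OF sj] unfolding t by blast
          have "g x = a + c * x" using j M by (intro ac) (simp_all add: field_simps)
          moreover have "d j = (a + c * ((real j + 1/2) / real M)) / real M"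
            unfolding d_def using M by (subst ac) (simp_all add: field_simps)
          moreover have "d (Suc j) = (a + c * ((real j + 3/2) / real M)) / real M"
            unfolding d_def using M ac[of "(real j + 3/2) / real M"] by (simp add: field_simps)
          moreover have "spline_sum 1 ?d ?y = ?d (int j) * (real j + 1 - ?y) + ?d (int j + 1) * (?y - real j)"
            using spline_sum_1[of "int j" ?y ?d] j by simp
          moreover have "?d (int j) = d j - D / real M" "?d (int j + 1) = d (Suc j) - D / real M"
            using diff[of j] diff[of "Suc j"] j(1) by (simp_all add: add.commute)
          moreover have "real M * (((a + c * ((real j + 1/2) / real M)) / real M - D / real M) * (real j + 1 - ?y) +
             ((a + c * ((real j + 3/2) / real M)) / real M - D / real M) * (?y - real j)) = a + c * x - D"
            using M by (simp add: field_simps)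
          ultimately show ?thesis by simp
        qed
      qed
    qed
    \<comment> \<open>The leftover constant D is harmless: it makes the difference affine, and the
      zeros at 0 and 1 then annihilate it.\<close>
    have "has_deriv01 (\<lambda>x. s x - spline_sum 2 b (real M * x)) (\<lambda>x. D)"
      by (rule has_deriv01_cong[OF _ gD has_deriv01_diff[OF g(2) has_deriv01_spline_sum[of 1 b "real M"]]])
        (simp_all add: numeral_2_eq_2)
    then have "s x - spline_sum 2 b (real M * x) = 0" if "x \<in> {0..1}" for x
      by (rule has_deriv01_const_imp_0[OF _ _ _ that])
        (use s spline_sum_boundary[OF b(1), of 2] in auto)
    then have "s = restrict01 (\<lambda>x. spline_sum 2 b (real M * x))"
      using s(1) by (auto simp: restrict01_def fun_eq_iff)
    with b(1) show "\<exists>b. odd_periodic M b \<and> s = restrict01 (\<lambda>x. spline_sum 2 b (real M * x))" by blast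
  qed
qed

section \<open>Surjectivity and injectivity in all degrees\<close>

lemma opt_space_eq:
  assumes M: "M \<ge> 1" and p: "p \<ge> 1"
  shows "s \<in> opt_space p (M - 1) \<longleftrightarrow>
    (\<exists>b. odd_periodic M b \<and> s = restrict01 (\<lambda>x. spline_sum p b (real M * x)))"
  using p
proof (induction p arbitrary: s rule: less_induct)
  case (less p)
  then consider "p = 1" | "p = 2" | q where "p = Suc (Suc q)" "q \<ge> 1"
    by (metis One_nat_def Suc_1 Suc_le_D le_SucE not_less_eq_eq le_zero_eq)
  then show ?case
    by cases (use opt_space_1[OF M] opt_space_2[OF M] opt_space_step[OF _ M less.IH] in auto)
qed

lemma spline_sum_inj:
  assumes M: "M \<ge> 1" and p: "p \<ge> 1" and b: "odd_periodic M b"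
    and z: "\<And>x. x \<in> {0..1} \<Longrightarrow> spline_sum p b (real M * x) = 0"
  shows "b l = 0"
  using p b z
proof (induction p arbitrary: b l rule: less_induct)
  case (less p)
  from less.prems(1) consider "p = 1" | "p = 2" | q where "p = Suc (Suc q)" "q \<ge> 1"
    by (metis One_nat_def Suc_1 Suc_le_D le_SucE not_less_eq_eq le_zero_eq)
  then show ?case
  proof cases
    case 1
    show ?thesis by (rule spline_sum_inj_1[OF less.prems(2) M]) (use less.prems(3) 1 in auto)
  next
    case 2
    show ?thesis by (rule spline_sum_inj_2[OF less.prems(2) M]) (use less.prems(3) 2 in auto)
  next
    case (3 q)
    show ?thesis
    proof (rule spline_sum_inj_step[OF 3(2) M _ less.prems(2)])
      show "c k = 0" if "odd_periodic M c" "\<And>x. x \<in> {0..1} \<Longrightarrow> spline_sum q c (real M * x) = 0" for c k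
        by (rule less.IH[of q]) (use 3 that in auto)
    qed (use less.prems(3) 3 in auto)
  qed
qed

section \<open>From coefficient sequences to bases\<close>

lemma sum_fun_apply: "(\<Sum>i\<in>I. f i) x = (\<Sum>i\<in>I. f i x)"
  by (induction I rule: infinite_finite_induct) (auto simp: zero_fun_def plus_fun_def)

text \<open>Independence and span speak of the image set, the hypotheses of indexed coefficients.
  Injectivity of f on I bridges the two and itself follows from indexed independence.\<close>

lemma is_basis_familyI:
  assumes fin: "finite I"
    and indep: "\<And>a i. (\<And>x. (\<Sum>i\<in>I. a i * f i x) = 0) \<Longrightarrow> i \<in> I \<Longrightarrow> a i = 0"
    and span: "\<And>s. s \<in> V \<longleftrightarrow> (\<exists>a. s = (\<lambda>x. \<Sum>i\<in>I. a i * f i x))"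
  shows "is_basis_family f I V"
proof -
  have inj: "inj_on f I"
  proof (rule inj_onI, rule ccontr)
    fix i j assume ij: "i \<in> I" "j \<in> I" "f i = f j" "i \<noteq> j"
    \<comment> \<open>Equal functions at distinct indices would satisfy the relation with
      coefficients 1 and -1.\<close>
    let ?a = "\<lambda>l. (if l = i then 1 else 0) - (if l = j then 1 else 0 :: real)"
    have "(\<Sum>l\<in>I. ?a l * f l x) = 0" for x
    proof -
      have "(\<Sum>l\<in>I. ?a l * f l x) = (\<Sum>l\<in>I. (if l = i then f i x else 0) - (if l = j then f j x else 0))"
        by (rule sum.cong) auto
      also have "\<dots> = f i x - f j x" using fin ij(1,2) by (simp add: sum_subtractf)
      finally show ?thesis using ij(3) by simp
    qed
    from indep[OF this ij(1)] show False using ij(4) by simp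
  qed
  have sum: "(\<Sum>v\<in>f ` I. fun_scale (u v) v) = (\<lambda>x. \<Sum>i\<in>I. u (f i) * f i x)" for u
    by (simp add: sum.reindex[OF inj] fun_eq_iff sum_fun_apply fun_scale_def)
  have "real_fun.independent (f ` I)"
    unfolding real_fun.dependent_finite[OF finite_imageI[OF fin]] sum
    using indep by (fastforce simp: fun_eq_iff zero_fun_def)
  moreover have "real_fun.span (f ` I) = V"
  proof -
    have "(\<exists>u. s = (\<lambda>x. \<Sum>i\<in>I. u (f i) * f i x)) \<longleftrightarrow> s \<in> V" for s
    proof
      assume "s \<in> V"
      then obtain a where a: "s = (\<lambda>x. \<Sum>i\<in>I. a i * f i x)" unfolding span by blast
      have "s = (\<lambda>x. \<Sum>i\<in>I. a (the_inv_into I f (f i)) * f i x)"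
        unfolding a by (intro ext sum.cong) (simp_all add: the_inv_into_f_f[OF inj])
      then show "\<exists>u. s = (\<lambda>x. \<Sum>i\<in>I. u (f i) * f i x)"
        by (intro exI[of _ "\<lambda>v. a (the_inv_into I f v)"])
    next
      assume "\<exists>u. s = (\<lambda>x. \<Sum>i\<in>I. u (f i) * f i x)"
      then obtain u where "s = (\<lambda>x. \<Sum>i\<in>I. u (f i) * f i x)" by blast
      then show "s \<in> V" unfolding span by (intro exI[of _ "\<lambda>i. u (f i)"])
    qed
    then show ?thesis
      unfolding real_fun.span_finite[OF finite_imageI[OF fin]] sum by blast
  qed
  ultimately show ?thesis using inj by (simp add: is_basis_family_def)
qed

lemma is_basis_family_opt_space:
  assumes M: "M \<ge> 1" and p: "p \<ge> 1"
    and f: "\<And>r. r \<in> {1..M - 1} \<Longrightarrow> f r = restrict01 (\<lambda>x. spline_sum p (odd_delta M r) (real M * x))"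
  shows "is_basis_family f {1..M - 1} (opt_space p (M - 1))"
proof (rule is_basis_familyI)
  let ?b = "\<lambda>a l. \<Sum>r\<in>{1..M - 1}. a r * odd_delta M r l"
  have odd: "odd_periodic M (?b a)" for a by (intro odd_periodic_sum odd_periodic_odd_delta)
  have sum: "(\<Sum>r\<in>{1..M - 1}. a r * f r x) = restrict01 (\<lambda>x. spline_sum p (?b a) (real M * x)) x" for a x
  proof -
    have "(\<Sum>r\<in>{1..M - 1}. a r * f r x) =
        (\<Sum>r\<in>{1..M - 1}. a r * restrict01 (\<lambda>x. spline_sum p (odd_delta M r) (real M * x)) x)"
      by (rule sum.cong) (simp_all add: f)
    then show ?thesis
      by (cases "x \<in> {0..1}")
        (simp_all add: restrict01_eq restrict01_eq_0 spline_sum_sum del: atLeastAtMost_iff)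
  qed
  show "a r = 0" if z: "\<And>x. (\<Sum>r\<in>{1..M - 1}. a r * f r x) = 0" and r: "r \<in> {1..M - 1}" for a r
  proof -
    have "?b a (int r) = 0"
      using z unfolding sum by (intro spline_sum_inj[OF M p odd]) (metis restrict01_eq)
    then show ?thesis using sum_odd_delta_nat[OF r, of a] by simp
  qed
  show "s \<in> opt_space p (M - 1) \<longleftrightarrow> (\<exists>a. s = (\<lambda>x. \<Sum>r\<in>{1..M - 1}. a r * f r x))" for s
    unfolding opt_space_eq[OF M p] sum using odd odd_periodic_eq_sum[OF _ M] by metis
qed simp

section \<open>The extraction matrix\<close>

lemma append_cols_index:
  assumes "i < dim_row A" "j < dim_col A + dim_col B"
  shows "(A @\<^sub>c B) $$ (i, j) = (if j < dim_col A then A $$ (i, j) else B $$ (i, j - dim_col A))"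
  using assms by (simp add: append_cols_def)

lemma append_cols_dim [simp]:
  "dim_row (A @\<^sub>c B) = dim_row A" "dim_col (A @\<^sub>c B) = dim_col A + dim_col B"
  by (simp_all add: append_cols_def)

lemma exchange_mat_dim [simp]: "dim_row (exchange_mat m) = m" "dim_col (exchange_mat m) = m"
  by (simp_all add: exchange_mat_def)

lemma L_mat_index:
  assumes "i < m" "q < 2 * m + 2"
  shows "L_mat m $$ (i, q) = (if q = i then 1 else if q + i = 2 * m then - 1 else 0)"
  using assms by (auto simp: L_mat_def append_cols_index exchange_mat_def)

lemma R_mat_index:
  assumes "i < m" "q < 2 * m + 2"
  shows "R_mat m $$ (i, q) = (if q + i = m then - 1 else if q = i + m + 2 then 1 else 0)"
  using assms by (auto simp: R_mat_def append_cols_index exchange_mat_def)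

text \<open>The window up to 3M covers one period of each kind of block: columns of L are read off
  at q + 1 and columns of R at q + M, with q below 2M. Only a few multiples of 2M can occur
  there.\<close>

lemma odd_delta_eq:
  assumes r: "r \<in> {1..M - 1}" and u: "0 \<le> u" "u < 3 * int M"
  shows "odd_delta M r u =
    (if u = int r \<or> u = 2 * int M + int r then 1 else 0) - (if u = 2 * int M - int r then 1 else 0)"
proof -
  have M: "2 * int M > 0" using r by auto
  have "2 * int M dvd u - int r \<longleftrightarrow> u = int r \<or> u = 2 * int M + int r"
  proof
    assume "2 * int M dvd u - int r"
    then obtain k where k: "u - int r = 2 * int M * k" by (rule dvdE)
    have "2 * int M * k > 2 * int M * (- 1)" "2 * int M * k < 2 * int M * 2"
      using r u unfolding k[symmetric] by auto
    then have "- 1 < k" "k < 2" by (simp_all only: mult_less_cancel_left_pos[OF M])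
    then have "k = 0 \<or> k = 1" by linarith
    then show "u = int r \<or> u = 2 * int M + int r" using k by auto
  qed auto
  moreover have "2 * int M dvd u + int r \<longleftrightarrow> u = 2 * int M - int r"
  proof
    assume "2 * int M dvd u + int r"
    then obtain k where k: "u + int r = 2 * int M * k" by (rule dvdE)
    have "2 * int M * k > 2 * int M * 0" "2 * int M * k < 2 * int M * 2"
      using r u unfolding k[symmetric] by auto
    then have "0 < k" "k < 2" by (simp_all only: mult_less_cancel_left_pos[OF M])
    then have "k = 1" by linarith
    then show "u = 2 * int M - int r" using k by auto
  qed auto
  ultimately show ?thesis by (simp add: odd_delta_def)
qed

text \<open>Column j carries the coefficient with index j + 1, because the central identity starts
  at column 0 but at index 1. The blocks L and R have width 2(M - 1) + 2 = 2M, exactly one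
  period.\<close>

lemma biinfinite_entry_eq:
  assumes r: "r \<in> {1..M - 1}"
  shows "biinfinite_entry (M - 1) (r - 1) j = odd_delta M r (j + 1)"
proof -
  have M: "int M > 0" and i: "r - 1 < M - 1" and two: "2 * (M - 1) + 2 = 2 * M" using r by auto
  have mod: "odd_delta M r u = odd_delta M r v" if "u mod (2 * int M) = v mod (2 * int M)" for u v
    using odd_periodic_mod[OF odd_periodic_odd_delta, of M r u] odd_periodic_mod[OF odd_periodic_odd_delta, of M r v]
      that by simp
  consider "j < 0" | "0 \<le> j" "j < int (M - 1)" | "int (M - 1) \<le> j" by linarith
  then show ?thesis
  proof cases
    case 1
    define q where "q = nat (j mod (2 * int M))"
    have q: "int q = j mod (2 * int M)" "q < 2 * M"
      using M pos_mod_bound[of "2 * int M" j] by (simp_all add: q_def nat_less_iff)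
    have "odd_delta M r (j + 1) = odd_delta M r (int q + 1)"
      by (rule mod) (simp add: q(1) mod_simps)
    also have "\<dots> = L_mat (M - 1) $$ (r - 1, q)"
    proof -
      have "int q + 1 = int r \<longleftrightarrow> q = r - 1" "int q + 1 \<noteq> 2 * int M + int r"
        "int q + 1 = 2 * int M - int r \<longleftrightarrow> q + (r - 1) = 2 * (M - 1)"
        using r q(2) by auto
      moreover have "0 \<le> int q + 1" "int q + 1 < 3 * int M" "\<not> (q = r - 1 \<and> q + (r - 1) = 2 * (M - 1))"
        using r q(2) by auto
      ultimately show ?thesis
        using L_mat_index[OF i, of q] q(2) two odd_delta_eq[OF r, of "int q + 1"] by simp
    qed
    finally show ?thesis using 1 two by (simp add: biinfinite_entry_def q_def)
  next
    case 2
    then have "odd_delta M r (j + 1) = (if j = int (r - 1) then 1 else 0)"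
      using r by (subst odd_delta_eq[OF r]) auto
    moreover have "nat j < M - 1" "nat j = r - 1 \<longleftrightarrow> j = int (r - 1)" using 2 by auto
    ultimately show ?thesis using 2 i by (auto simp: biinfinite_entry_def)
  next
    case 3
    define q where "q = nat ((j - int (M - 1)) mod (2 * int M))"
    have q: "int q = (j - int (M - 1)) mod (2 * int M)" "q < 2 * M"
      using M pos_mod_bound[of "2 * int M" "j - int (M - 1)"] by (simp_all add: q_def nat_less_iff)
    \<comment> \<open>The first column of R is column M - 1, hence coefficient index M.\<close>
    have "odd_delta M r (j + 1) = odd_delta M r (int q + int M)"
    proof (rule mod)
      have "(int q + int M) mod (2 * int M) = (j - int (M - 1) + int M) mod (2 * int M)"
        unfolding q(1) by (rule mod_add_left_eq)
      also have "j - int (M - 1) + int M = j + 1" using r by auto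
      finally show "(j + 1) mod (2 * int M) = (int q + int M) mod (2 * int M)" by simp
    qed
    also have "\<dots> = R_mat (M - 1) $$ (r - 1, q)"
    proof -
      have "int q + int M \<noteq> int r" "int q + int M = 2 * int M + int r \<longleftrightarrow> q = r - 1 + (M - 1) + 2"
        "int q + int M = 2 * int M - int r \<longleftrightarrow> q + (r - 1) = M - 1"
        using r q(2) by auto
      moreover have "0 \<le> int q + int M" "int q + int M < 3 * int M" "\<not> (q = r - 1 + (M - 1) + 2 \<and> q + (r - 1) = M - 1)"
        using r q(2) by auto
      ultimately show ?thesis
        using R_mat_index[OF i, of q] q(2) two odd_delta_eq[OF r, of "int q + int M"] by simp
    qed
    finally show ?thesis using 3 two by (simp add: biinfinite_entry_def q_def)
  qed
qed

text \<open>Column c belongs to the translate centered at c - k + 1, so the kept columns are the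
  centers from 1 - k to M + k - 1. Since k is at least half the support length, every translate that
  is nonzero somewhere on [0,1] is among them.\<close>

lemma reduced_bspline_eq:
  assumes r: "r \<in> {1..M - 1}" and p: "p \<ge> 1" and k: "p + 1 \<le> 2 * k" "M - 1 + 2 * k = nel + p"
    and bs: "\<And>x c. bspline p nel \<xi> (int c - int p) x = centered_bspline p (real M * x - of_int (int c - int k + 1))"
  shows "reduced_bspline p nel \<xi> (M - 1) k r =
    restrict01 (\<lambda>x. spline_sum p (odd_delta M r) (real M * x))"
proof
  fix x
  have i: "r - 1 < M - 1" using r by auto
  show "reduced_bspline p nel \<xi> (M - 1) k r x =
    restrict01 (\<lambda>x. spline_sum p (odd_delta M r) (real M * x)) x"
  proof (cases "x \<in> {0..1}")
    case True
    let ?A = "(\<lambda>c. int c - int k + 1) ` {0..<nel + p}"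
    have "spline_sum p (odd_delta M r) (real M * x) =
      (\<Sum>l\<in>?A. odd_delta M r l * centered_bspline p (real M * x - of_int l))"
    proof (rule spline_sum_eq)
      show "{l. centered_bspline p (real M * x - of_int l) \<noteq> 0} \<subseteq> ?A"
      proof
        fix l assume "l \<in> {l. centered_bspline p (real M * x - of_int l) \<noteq> 0}"
        then have "\<bar>real M * x - of_int l\<bar> < (real p + 1) / 2"
          using centered_bspline_eq_0[OF p, of "real M * x - of_int l"] by force
        also have "(real p + 1) / 2 \<le> real k" using of_nat_mono[OF k(1), where ?'a = real] by simp
        finally have "\<bar>real M * x - of_int l\<bar> < real k" .
        moreover have "0 \<le> real M * x" "real M * x \<le> real M"
          using True mult_left_mono[of x 1 "real M"] by auto
        ultimately have "- int k < l" "l < int M + int k" by linarith+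
        then have "l = int (nat (l + int k - 1)) - int k + 1" "nat (l + int k - 1) \<in> {0..<nel + p}"
          using k(2) r by auto
        then show "l \<in> ?A" by blast
      qed
    qed simp
    also have "\<dots> = (\<Sum>c\<in>{0..<nel + p}. odd_delta M r (int c - int k + 1) * centered_bspline p (real M * x - of_int (int c - int k + 1)))"
      by (subst sum.reindex) (auto simp: inj_on_def)
    also have "\<dots> = (\<Sum>c\<in>{0..<nel + p}. extraction_mat (M - 1) k $$ (r - 1, c) * bspline p nel \<xi> (int c - int p) x)"
    proof (rule sum.cong[OF refl])
      fix c assume "c \<in> {0..<nel + p}"
      then have "extraction_mat (M - 1) k $$ (r - 1, c) = biinfinite_entry (M - 1) (r - 1) (int c - int k)"
        using i k(2) by (simp add: extraction_mat_def)
      then show "odd_delta M r (int c - int k + 1) * centered_bspline p (real M * x - of_int (int c - int k + 1)) =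
        extraction_mat (M - 1) k $$ (r - 1, c) * bspline p nel \<xi> (int c - int p) x"
        by (simp only: biinfinite_entry_eq[OF r] bs)
    qed
    also have "\<dots> = (extraction_mat (M - 1) k *\<^sub>v
        Matrix.vec (nel + p) (\<lambda>c. bspline p nel \<xi> (int c - int p) x)) $ (r - 1)"
      using i k(2) by (simp add: extraction_mat_def scalar_prod_def)
    finally show ?thesis using True by (simp add: reduced_bspline_def restrict01_eq)
  qed (simp add: reduced_bspline_def restrict01_eq_0)
qed

section \<open>The two knot sequences\<close>

theorem proposition6p1:
  fixes p nel :: nat
  shows
    "(p \<ge> 1 \<and> odd p \<and> nel \<ge> 2 \<longrightarrow>
        is_basis_family
          (reduced_bspline p nel (\<lambda>i. real_of_int i / real nel) (nel - 1) ((p + 1) div 2))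
          {1..nel - 1} (opt_space p (nel - 1)))
     \<and>
     (p \<ge> 2 \<and> even p \<and> nel \<ge> 3 \<longrightarrow>
        is_basis_family
          (reduced_bspline p nel (\<lambda>i. (real_of_int i - 1 / 2) / (real nel - 1)) (nel - 2) (p div 2 + 1))
          {1..nel - 2} (opt_space p (nel - 2)))"
proof (intro conjI impI)
  assume a: "p \<ge> 1 \<and> odd p \<and> nel \<ge> 2"
  then obtain k where k: "(p + 1) div 2 = k" "p + 1 = 2 * k" by auto
  have k': "real p = 2 * real k - 1" using arg_cong[OF k(2), of real] by simp
  have bs: "bspline p nel (\<lambda>i. real_of_int i / real nel) (int c - int p) x =
      centered_bspline p (real nel * x - of_int (int c - int k + 1))" for c x
  proof -
    \<comment> \<open>For odd degree half the support length is the integer k, so integer knots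
      already have integer centers.\<close>
    have "real nel * (x - real_of_int (int c - int p) / real nel) / (real_of_int (int nel) / real nel - real_of_int 0 / real nel)
      = real nel * x - of_int (int c - int k + 1) + (real p + 1) / 2"
      using a by (simp add: k' field_simps)
    then show ?thesis unfolding bspline_def centered_bspline_def by simp
  qed
  show "is_basis_family (reduced_bspline p nel (\<lambda>i. real_of_int i / real nel) (nel - 1) ((p + 1) div 2))
    {1..nel - 1} (opt_space p (nel - 1))"
  proof (rule is_basis_family_opt_space)
    show "reduced_bspline p nel (\<lambda>i. real_of_int i / real nel) (nel - 1) ((p + 1) div 2) r =
      restrict01 (\<lambda>x. spline_sum p (odd_delta nel r) (real nel * x))" if "r \<in> {1..nel - 1}" for r
      using a k unfolding k(1) by (intro reduced_bspline_eq[OF that _ _ _ bs]) auto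
  qed (use a in auto)
next
  assume a: "p \<ge> 2 \<and> even p \<and> nel \<ge> 3"
  let ?M = "nel - 1"
  from a obtain k where k: "p div 2 + 1 = k" "p + 2 = 2 * k" by auto
  have k': "real p = 2 * real k - 2" using arg_cong[OF k(2), of real] by simp
  have M: "real nel - 1 = real ?M" "real nel = real ?M + 1" "real ?M > 0" using a by auto
  have bs: "bspline p nel (\<lambda>i. (real_of_int i - 1 / 2) / (real nel - 1)) (int c - int p) x =
      centered_bspline p (real ?M * x - of_int (int c - int k + 1))" for c x
  proof -
    \<comment> \<open>The knots span \<open>nel / (nel - 1)\<close>, which rescales the argument by
      \<open>nel - 1\<close>. For even degree integer knots would give half-integer centers; the
      offset 1/2 in the knots makes them integers.\<close>
    have "real nel * (x - (real_of_int (int c - int p) - 1 / 2) / (real nel - 1)) /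
        ((real_of_int (int nel) - 1 / 2) / (real nel - 1) - (real_of_int 0 - 1 / 2) / (real nel - 1))
      = (real nel - 1) * x - (real c - real p - 1 / 2)"
      using a by (simp add: field_simps)
    also have "\<dots> = real ?M * x - of_int (int c - int k + 1) + (real p + 1) / 2"
      unfolding M(1) of_int_diff of_int_add of_int_of_nat_eq k' by (simp add: field_simps)
    finally show ?thesis unfolding bspline_def centered_bspline_def by simp
  qed
  have "is_basis_family (reduced_bspline p nel (\<lambda>i. (real_of_int i - 1 / 2) / (real nel - 1)) (?M - 1) (p div 2 + 1))
    {1..?M - 1} (opt_space p (?M - 1))"
  proof (rule is_basis_family_opt_space)
    show "reduced_bspline p nel (\<lambda>i. (real_of_int i - 1 / 2) / (real nel - 1)) (?M - 1) (p div 2 + 1) r =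
      restrict01 (\<lambda>x. spline_sum p (odd_delta ?M r) (real ?M * x))" if "r \<in> {1..?M - 1}" for r
      using a k unfolding k(1) by (intro reduced_bspline_eq[OF that _ _ _ bs]) auto
  qed (use a in auto)
  then show "is_basis_family
      (reduced_bspline p nel (\<lambda>i. (real_of_int i - 1 / 2) / (real nel - 1)) (nel - 2) (p div 2 + 1))
      {1..nel - 2} (opt_space p (nel - 2))"
    by (simp add: numeral_2_eq_2)
qed

end
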